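(* The ray $[0,\infty)$, with its standard metric $|x-y|$, is isometrically rigid with respect to $\mathbb{P}_p$ for any $p\ge 1$.
   Context: For a metric space $(X,d)$ and $p\ge1$, $\mathbb{P}_p(X)$ is the set of Borel probability measures on $X$ with finite $p$-moment, with the metric $W_p(\mu,\nu)=\inf_\pi\left(\int_{X\times X}d(x,y)^p\,d\pi(x,y)\right)^{1/p}$, where $\pi$ ranges over Borel probability measures on $X\times X$ with marginals $\mu$ and $\nu$. An isometry of a metric space is a surjective distance-preserving self-map. Each $\varphi\in\operatorname{Isom}(X)$ induces by push-forward an isometry $\varphi_\#$ of $\mathbb{P}_p(X)$. $X$ is isometrically rigid with respect to $\mathbb{P}_p$ if every isometry of $(\mathbb{P}_p(X),W_p)$ is of the form $\varphi_\#$ for some $\varphi\in\operatorname{Isom}(X)$. *)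

theory Defs
  imports "HOL-Probability.Probability"
begin

definition borel_of :: "'a topology \<Rightarrow> 'a measure" where
  "borel_of T = sigma (topspace T) {U. openin T U}"

abbreviation metric_borel :: "'a set \<Rightarrow> ('a \<Rightarrow> 'a \<Rightarrow> real) \<Rightarrow> 'a measure" where
  "metric_borel X d \<equiv> borel_of (Metric_space.mtopology X d)"

definition prob_measures :: "'a topology \<Rightarrow> 'a measure set" where
  "prob_measures T = {\<mu>. sets \<mu> = sets (borel_of T) \<and> prob_space \<mu>}"

text \<open>By the triangle inequality, finiteness of the moment does not depend on the base point.\<close>

definition wasserstein_space ::
    "real \<Rightarrow> 'a set \<Rightarrow> ('a \<Rightarrow> 'a \<Rightarrow> real) \<Rightarrow> 'a measure set" where
  "wasserstein_space p X d =
     {\<mu> \<in> prob_measures (Metric_space.mtopology X d).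
        \<exists>x\<^sub>0\<in>X. integrable \<mu> (\<lambda>x. d x x\<^sub>0 powr p)}"

definition couplings ::
    "'a set \<Rightarrow> ('a \<Rightarrow> 'a \<Rightarrow> real) \<Rightarrow> 'a measure \<Rightarrow> 'a measure \<Rightarrow> ('a \<times> 'a) measure set" where
  "couplings X d \<mu> \<nu> =
     {\<pi> \<in> prob_measures
              (prod_topology (Metric_space.mtopology X d) (Metric_space.mtopology X d)).
        distr \<pi> (metric_borel X d) fst = \<mu> \<and> distr \<pi> (metric_borel X d) snd = \<nu>}"

text \<open>
  The integral is the real-valued Bochner integral, which is \<open>0\<close> on non-integrable functions.
  This value does not arise for \<open>\<mu>\<close> and \<open>\<nu>\<close> in the Wasserstein space: for \<open>p \<ge> 1\<close>,
  \<open>d x y powr p \<le> 2 powr (p - 1) * (d x x\<^sub>0 powr p + d x\<^sub>0 y powr p)\<close>, so the integrand is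
  integrable with respect to every coupling.
\<close>

definition wasserstein_dist ::
    "real \<Rightarrow> 'a set \<Rightarrow> ('a \<Rightarrow> 'a \<Rightarrow> real) \<Rightarrow> 'a measure \<Rightarrow> 'a measure \<Rightarrow> real" where
  "wasserstein_dist p X d \<mu> \<nu> =
     (INF \<pi>\<in>couplings X d \<mu> \<nu>. (\<integral>(x, y). d x y powr p \<partial>\<pi>) powr (1 / p))"

definition self_isometry :: "'a set \<Rightarrow> ('a \<Rightarrow> 'a \<Rightarrow> real) \<Rightarrow> ('a \<Rightarrow> 'a) \<Rightarrow> bool" where
  "self_isometry X d f \<longleftrightarrow> f ` X = X \<and> (\<forall>x\<in>X. \<forall>y\<in>X. d (f x) (f y) = d x y)"

definition isometrically_rigid :: "real \<Rightarrow> 'a set \<Rightarrow> ('a \<Rightarrow> 'a \<Rightarrow> real) \<Rightarrow> bool" where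
  "isometrically_rigid p X d \<longleftrightarrow>
     (\<forall>\<Phi>. self_isometry (wasserstein_space p X d) (wasserstein_dist p X d) \<Phi> \<longrightarrow>
        (\<exists>\<phi>. self_isometry X d \<phi> \<and>
             (\<forall>\<mu>\<in>wasserstein_space p X d. \<Phi> \<mu> = distr \<mu> (metric_borel X d) \<phi>)))"

end

theory Submission
  imports Defs
begin

text \<open>
  Through quantile functions the Wasserstein space of the ray becomes the convex cone of nondecreasing
  nonnegative functions in \<open>L\<^sup>p(0,1)\<close>; here \<open>pcost\<close> is the \<open>p\<close>-th power of the distance.
  An isometry fixes the apex \<open>0\<close>, the only point that is not a midpoint of two others. Hence it
  preserves the metric characterisations of the step functions \<open>s \<cdot> 1\<^bsub>(c,1)\<^esub>\<close>: they span the extreme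
  rays of the cone if \<open>p > 1\<close>, and they are the join-irreducible elements if \<open>p = 1\<close>. On each sphere
  about \<open>0\<close>, the distance of two step functions depends strictly monotonically on
  \<open>\<bar>ln (1 - c) - ln (1 - d)\<bar>\<close>, so the isometry acts on the parameters \<open>- ln (1 - c)\<close> as an
  isometry of a half-line, that is, trivially. Finally, a quantile function is determined by its
  distances to all step functions, because \<open>\<bar>q - s\<bar> powr p - q powr p\<close> is strictly decreasing in
  \<open>q \<in> [0, s]\<close>.
\<close>

text \<open>A step function has two parameters. Distances to the apex freeze one of them, and what
  remains on a sphere is a curve indexed by the mass \<open>b = 1 - c\<close> away from the origin.
  Steps on one sphere differ by trading mass against height, so their distances see only the ratio
  of the masses. The curve has an end, the Dirac measure at \<open>b = 1\<close>, and this end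
  excludes reflections and translations of the parameter. Step functions suffice as test points
  because the costs from a given function to two steps of equal height differ only by an integral
  over the interval between the two jumps. The recurring obstacle is that distances determine
  functions only almost everywhere, whereas the order arguments are pointwise. Every interval has
  positive measure, so a property valid almost everywhere holds somewhere in each interval, and
  monotonicity spreads it from there.\<close>

subsection \<open>Convexity of powers\<close>

text \<open>The mean value theorem is applied to both halves of \<open>[x, y]\<close>: they have
  equal length, and the derivative of \<open>t powr p\<close> is strictly larger on the right
  one.\<close>

lemma powr_midpoint_less:
  fixes x y p :: real
  assumes "p > 1" "0 \<le> x" "x < y"
  shows "2 * ((x + y) / 2) powr p < x powr p + y powr p"
proof -
  define m where "m = (x + y) / 2"
  have xm: "x < m" "m < y" "0 < m" using assms by (auto simp: m_def)
  have der: "((\<lambda>t. t powr p) has_real_derivative p * t powr (p - 1)) (at t)" if "0 < t" for t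
    using that by (auto intro!: derivative_eq_intros)
  have cont: "continuous_on {u..v} (\<lambda>t. t powr p)" if "0 \<le> u" for u v :: real
    using assms that by (intro continuous_on_powr' continuous_intros) auto
  obtain a where a: "x < a" "a < m" "m powr p - x powr p = (m - x) * (p * a powr (p - 1))"
    using mvt[OF xm(1) cont[OF assms(2)], of "\<lambda>t d. d * (p * t powr (p - 1))"] der assms
    by (auto simp: has_field_derivative_def mult_commute_abs)
  obtain b where b: "m < b" "b < y" "y powr p - m powr p = (y - m) * (p * b powr (p - 1))"
    using mvt[OF xm(2) cont[of m], of "\<lambda>t d. d * (p * t powr (p - 1))"] der xm
    by (auto simp: has_field_derivative_def mult_commute_abs)
  have "a powr (p - 1) < b powr (p - 1)"
    using a b assms by (intro powr_less_mono2) auto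
  then have "(m - x) * (p * a powr (p - 1)) < (y - m) * (p * b powr (p - 1))"
    using xm assms mult_strict_left_mono[of "a powr (p - 1)" "b powr (p - 1)" "(y - x) / 2 * p"]
    by (simp add: m_def field_simps)
  with a b show ?thesis by (simp add: m_def)
qed

text \<open>Equality case of convexity at the midpoint, scaled to avoid division. Strict convexity
  forces \<open>|a| = |b|\<close>, and opposite signs would make the right-hand side vanish.\<close>

lemma abs_add_powr_eqD:
  fixes a b p :: real
  assumes "p > 1" "2 powr p * (\<bar>a\<bar> powr p + \<bar>b\<bar> powr p) \<le> 2 * \<bar>a + b\<bar> powr p"
  shows "a = b"
proof -
  have half: "2 * (z / 2) powr p * 2 powr p = 2 * z powr p" if "z \<ge> 0" for z :: real
    using that by (simp add: powr_divide)
  have le: "2 * \<bar>a + b\<bar> powr p \<le> 2 * (\<bar>a\<bar> + \<bar>b\<bar>) powr p"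
    using assms by (intro mult_left_mono powr_mono2) auto
  have "\<bar>a\<bar> = \<bar>b\<bar>"
  proof (rule ccontr)
    assume "\<bar>a\<bar> \<noteq> \<bar>b\<bar>"
    then have "2 * ((\<bar>a\<bar> + \<bar>b\<bar>) / 2) powr p < \<bar>a\<bar> powr p + \<bar>b\<bar> powr p"
      using powr_midpoint_less[of p "\<bar>a\<bar>" "\<bar>b\<bar>"] powr_midpoint_less[of p "\<bar>b\<bar>" "\<bar>a\<bar>"] assms
      by (cases "\<bar>a\<bar> < \<bar>b\<bar>") (auto simp: add.commute)
    then have "2 * ((\<bar>a\<bar> + \<bar>b\<bar>) / 2) powr p * 2 powr p < (\<bar>a\<bar> powr p + \<bar>b\<bar> powr p) * 2 powr p"
      by (intro mult_strict_right_mono) auto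
    then show False
      using half[of "\<bar>a\<bar> + \<bar>b\<bar>"] le assms(2)
      by (simp add: algebra_simps)
  qed
  show ?thesis
  proof (rule ccontr)
    assume "a \<noteq> b"
    with \<open>\<bar>a\<bar> = \<bar>b\<bar>\<close> have "a = - b" "b \<noteq> 0" by auto
    then have "2 powr p * (2 * \<bar>b\<bar> powr p) \<le> 0"
      using assms by simp
    then show False using \<open>b \<noteq> 0\<close> by (simp add: mult_le_0_iff)
  qed
qed

text \<open>For \<open>p > 1\<close>, a violation would satisfy the premise of
  \<open>abs_add_powr_eqD\<close>, hence \<open>a = b\<close>, where both sides agree.\<close>

lemma abs_add_powr_le:
  fixes a b p :: real
  assumes "p \<ge> 1"
  shows "2 * \<bar>a + b\<bar> powr p \<le> 2 powr p * (\<bar>a\<bar> powr p + \<bar>b\<bar> powr p)"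
proof (cases "p = 1")
  case True
  then show ?thesis using abs_triangle_ineq[of a b] by simp
next
  case False
  then have p: "p > 1" using assms by auto
  show ?thesis
  proof (cases "a = b")
    case True
    then have "a + b = 2 * a" by simp
    then show ?thesis using True by (simp add: abs_mult powr_mult)
  next
    case False
    then show ?thesis using abs_add_powr_eqD[OF p, of a b] by linarith
  qed
qed

subsection \<open>The cone of quantile functions\<close>

text \<open>The interval is open because a quantile function may be unbounded near \<open>1\<close>,
  and because the pseudoinverse of a distribution function has this domain.\<close>

definition unit_ivl :: "real measure" where
  "unit_ivl = restrict_space lborel {0<..<1}"

lemma space_unit_ivl [simp]: "space unit_ivl = {0<..<1}"
  by (simp add: unit_ivl_def space_restrict_space)

lemma measurable_unit_ivl: "measurable unit_ivl M = measurable (restrict_space borel {0<..<1}) M"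
  by (intro measurable_cong_sets) (auto simp: unit_ivl_def sets_restrict_space)

lemma emeasure_unit_ivl: "A \<in> sets borel \<Longrightarrow> A \<subseteq> {0<..<1} \<Longrightarrow> emeasure unit_ivl A = emeasure lborel A"
  by (simp add: unit_ivl_def emeasure_restrict_space)

interpretation unit_ivl: prob_space unit_ivl
  by (rule prob_spaceI) (simp add: emeasure_unit_ivl)

lemma sets_unit_ivl: "A \<in> sets unit_ivl \<longleftrightarrow> A \<in> sets borel \<and> A \<subseteq> {0<..<1}"
  by (auto simp: unit_ivl_def sets_restrict_space_iff)

lemma measure_unit_ivl_Ioc: "0 \<le> a \<Longrightarrow> a < b \<Longrightarrow> b < 1 \<Longrightarrow> measure unit_ivl {a<..b} = b - a"
  by (subst measure_def, subst emeasure_unit_ivl) auto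

lemma measure_unit_ivl_Ioo: "0 \<le> a \<Longrightarrow> a < 1 \<Longrightarrow> measure unit_ivl {a<..<1} = 1 - a"
  by (subst measure_def, subst emeasure_unit_ivl) auto

lemma AE_unit_ivl_obtain:
  assumes "AE \<omega> in unit_ivl. P \<omega>" "0 \<le> a" "a < b" "b \<le> 1"
  obtains \<omega> where "a < \<omega>" "\<omega> < b" "P \<omega>"
proof -
  have "\<exists>\<omega>. a < \<omega> \<and> \<omega> < b \<and> P \<omega>"
  proof (rule ccontr)
    assume "\<not> ?thesis"
    then have "AE \<omega> in unit_ivl. \<omega> \<notin> {a<..<b}"
      using assms(1) by (auto elim!: eventually_mono)
    then have "emeasure unit_ivl {a<..<b} = 0"
      using assms by (subst (asm) AE_iff_measurable[of "{a<..<b}"]) (auto simp: sets_unit_ivl)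
    then show False
      using assms by (subst (asm) emeasure_unit_ivl) auto
  qed
  with that show thesis by blast
qed

lemma AE_lborel_imp_unit_ivl:
  assumes "AE \<omega> in lborel. P \<omega>"
  shows "AE \<omega> in unit_ivl. P \<omega>"
  using assms unfolding unit_ivl_def by (subst AE_restrict_space_iff) auto

text \<open>No one-sided continuity is demanded, so a measure has many quantile functions, equal
  almost everywhere. In return, membership is checked by monotonicity and domination alone.\<close>

definition quantile_fun :: "real \<Rightarrow> (real \<Rightarrow> real) \<Rightarrow> bool" where
  "quantile_fun p f \<longleftrightarrow> mono_on {0<..<1} f \<and> (\<forall>\<omega>\<in>{0<..<1}. 0 \<le> f \<omega>) \<and>
     integrable unit_ivl (\<lambda>\<omega>. f \<omega> powr p)"

text \<open>Without the root, pointwise identities and inequalities between \<open>p\<close>-th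
  powers integrate directly.\<close>

definition pcost :: "real \<Rightarrow> (real \<Rightarrow> real) \<Rightarrow> (real \<Rightarrow> real) \<Rightarrow> real" where
  "pcost p f g = (\<integral>\<omega>. \<bar>f \<omega> - g \<omega>\<bar> powr p \<partial>unit_ivl)"

text \<open>For \<open>0 \<le> c < 1\<close> and \<open>s \<ge> 0\<close>, a quantile function of
  the measure with mass \<open>c\<close> at \<open>0\<close> and mass \<open>1 - c\<close> at
  \<open>s\<close>.\<close>

definition step :: "real \<Rightarrow> real \<Rightarrow> real \<Rightarrow> real" where
  "step c s \<omega> = (if c < \<omega> then s else 0)"

text \<open>The value \<open>s = 0\<close> is allowed, so the apex counts as a step;
  \<open>c = 0\<close> gives the Dirac measures.\<close>

definition ae_step :: "(real \<Rightarrow> real) \<Rightarrow> bool" where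
  "ae_step f \<longleftrightarrow> (\<exists>c s. 0 \<le> c \<and> c < 1 \<and> 0 \<le> s \<and> (AE \<omega> in unit_ivl. f \<omega> = step c s \<omega>))"

lemma borel_measurable_mono_unit_ivl:
  fixes f :: "real \<Rightarrow> real"
  shows "mono_on {0<..<1} f \<Longrightarrow> f \<in> borel_measurable unit_ivl"
  using borel_measurable_mono_on_fnc[of "{0<..<1}" f] by (simp add: measurable_unit_ivl)

lemma quantile_funD:
  assumes f: "quantile_fun p f"
  shows "f \<in> borel_measurable unit_ivl" "integrable unit_ivl (\<lambda>\<omega>. f \<omega> powr p)"
    and "\<And>x. 0 < x \<Longrightarrow> x < 1 \<Longrightarrow> 0 \<le> f x"
    and "\<And>x y. 0 < x \<Longrightarrow> x \<le> y \<Longrightarrow> y < 1 \<Longrightarrow> f x \<le> f y"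
proof -
  show "f \<in> borel_measurable unit_ivl"
    using f borel_measurable_mono_unit_ivl[of f] by (simp only: quantile_fun_def)
  show "integrable unit_ivl (\<lambda>\<omega>. f \<omega> powr p)"
    using f by (simp only: quantile_fun_def)
  show "0 \<le> f x" if "0 < x" "x < 1" for x
    using f that by (simp add: quantile_fun_def)
  show "f x \<le> f y" if "0 < x" "x \<le> y" "y < 1" for x y
    using f that by (intro mono_onD[of "{0<..<1}" f]) (auto simp: quantile_fun_def)
qed

text \<open>The factor 2 makes room for the doubled function in \<open>zero_AE_zero\<close> and for
  the reflections through \<open>f\<close> in \<open>nonstep_midpoints\<close>.\<close>

lemma quantile_fun_dominated:
  assumes f: "quantile_fun p f" and p: "p \<ge> 1" and g: "mono_on {0<..<1} g"
    and "\<And>\<omega>. 0 < \<omega> \<Longrightarrow> \<omega> < 1 \<Longrightarrow> 0 \<le> g \<omega>"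
    and "\<And>\<omega>. 0 < \<omega> \<Longrightarrow> \<omega> < 1 \<Longrightarrow> g \<omega> \<le> 2 * f \<omega>"
  shows "quantile_fun p g"
  unfolding quantile_fun_def
proof (intro conjI ballI g)
  note [measurable] = borel_measurable_mono_unit_ivl[OF g]
  show "integrable unit_ivl (\<lambda>\<omega>. g \<omega> powr p)"
  proof (rule Bochner_Integration.integrable_bound)
    show "integrable unit_ivl (\<lambda>\<omega>. 2 powr p * f \<omega> powr p)"
      using quantile_funD(2)[OF f] by simp
    show "AE \<omega> in unit_ivl. norm (g \<omega> powr p) \<le> norm (2 powr p * f \<omega> powr p)"
    proof (rule AE_I2)
      fix \<omega> assume "\<omega> \<in> space unit_ivl"
      then have "0 < \<omega>" "\<omega> < 1" by auto
      then have "g \<omega> powr p \<le> (2 * f \<omega>) powr p"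
        using assms by (intro powr_mono2) auto
      then show "norm (g \<omega> powr p) \<le> norm (2 powr p * f \<omega> powr p)"
        using quantile_funD(3)[OF f, of \<omega>] \<open>0 < \<omega>\<close> \<open>\<omega> < 1\<close> by (simp add: powr_mult)
    qed
  qed measurable
qed (use assms in auto)

lemma quantile_fun_step:
  assumes "0 \<le> s"
  shows "quantile_fun p (step c s)"
  unfolding quantile_fun_def
proof (intro conjI ballI)
  show m: "mono_on {0<..<1} (step c s)"
    using assms by (auto simp: mono_on_def step_def)
  note [measurable] = borel_measurable_mono_unit_ivl[OF m]
  show "integrable unit_ivl (\<lambda>\<omega>. step c s \<omega> powr p)"
    by (rule unit_ivl.integrable_const_bound[OF AE_I2[of unit_ivl "\<lambda>\<omega>. norm (step c s \<omega> powr p) \<le> s powr p"]])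
      (simp add: step_def, measurable)
qed (use assms in \<open>auto simp: step_def\<close>)

lemma quantile_fun_zero: "quantile_fun p (\<lambda>_. 0)"
  using quantile_fun_step[of 0 p 0] by (simp add: step_def[abs_def] cong: if_cong)

section \<open>Basic properties of the cost\<close>

lemma integrable_pcost:
  assumes f: "quantile_fun p f" and g: "quantile_fun p g" and p: "p \<ge> 1"
  shows "integrable unit_ivl (\<lambda>\<omega>. \<bar>f \<omega> - g \<omega>\<bar> powr p)"
proof (rule Bochner_Integration.integrable_bound)
  note [measurable] = quantile_funD(1)[OF f] quantile_funD(1)[OF g]
  show "(\<lambda>\<omega>. \<bar>f \<omega> - g \<omega>\<bar> powr p) \<in> borel_measurable unit_ivl" by measurable
  show "integrable unit_ivl (\<lambda>\<omega>. f \<omega> powr p + g \<omega> powr p)"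
    using quantile_funD(2)[OF f] quantile_funD(2)[OF g] by simp
  show "AE \<omega> in unit_ivl. norm (\<bar>f \<omega> - g \<omega>\<bar> powr p) \<le> norm (f \<omega> powr p + g \<omega> powr p)"
  proof (rule AE_I2)
    fix \<omega> assume "\<omega> \<in> space unit_ivl"
    then have *: "0 \<le> f \<omega>" "0 \<le> g \<omega>" using quantile_funD(3)[OF f] quantile_funD(3)[OF g] by auto
    show "norm (\<bar>f \<omega> - g \<omega>\<bar> powr p) \<le> norm (f \<omega> powr p + g \<omega> powr p)"
    proof (cases "f \<omega> \<le> g \<omega>")
      case True
      then have "\<bar>f \<omega> - g \<omega>\<bar> powr p \<le> g \<omega> powr p" using * p by (intro powr_mono2) auto
      then show ?thesis by (simp add: add_increasing)
    next
      case False
      then have "\<bar>f \<omega> - g \<omega>\<bar> powr p \<le> f \<omega> powr p" using * p by (intro powr_mono2) auto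
      then show ?thesis by (simp add: add_increasing2)
    qed
  qed
qed

lemma pcost_nonneg: "0 \<le> pcost p f g"
  by (simp add: pcost_def)

lemma pcost_commute: "pcost p f g = pcost p g f"
  by (simp add: pcost_def abs_minus_commute)

lemma pcost_zero_right:
  assumes "quantile_fun p f"
  shows "pcost p f (\<lambda>_. 0) = (\<integral>\<omega>. f \<omega> powr p \<partial>unit_ivl)"
  unfolding pcost_def using quantile_funD(3)[OF assms]
  by (intro Bochner_Integration.integral_cong) auto

lemma pcost_cong_AE:
  assumes "quantile_fun p f" "quantile_fun p f'" "quantile_fun p g" "quantile_fun p g'"
    and "AE \<omega> in unit_ivl. f \<omega> = f' \<omega>" "AE \<omega> in unit_ivl. g \<omega> = g' \<omega>"
  shows "pcost p f g = pcost p f' g'"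
proof -
  note [measurable] = assms(1-4)[THEN quantile_funD(1)]
  show ?thesis unfolding pcost_def
    by (rule integral_cong_AE; measurable) (use assms(5,6) in eventually_elim, simp)
qed

lemma pcost_eq_0_iff:
  assumes f: "quantile_fun p f" and g: "quantile_fun p g" and p: "p \<ge> 1"
  shows "pcost p f g = 0 \<longleftrightarrow> (AE \<omega> in unit_ivl. f \<omega> = g \<omega>)"
  unfolding pcost_def
  by (subst integral_nonneg_eq_0_iff_AE[OF integrable_pcost[OF assms]]) auto

text \<open>This is what turns equalities between distances into pointwise information.\<close>

lemma integral_eq_imp_AE_eq:
  fixes f g :: "'a \<Rightarrow> real"
  assumes "integrable M f" "integrable M g" "AE x in M. f x \<le> g x"
    and "integral\<^sup>L M g \<le> integral\<^sup>L M f"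
  shows "AE x in M. f x = g x"
proof -
  have "integral\<^sup>L M (\<lambda>x. g x - f x) \<le> 0" "0 \<le> integral\<^sup>L M (\<lambda>x. g x - f x)"
    using assms by (simp, intro integral_nonneg_AE) (auto elim!: eventually_mono)
  then have "integral\<^sup>L M (\<lambda>x. g x - f x) = 0" by simp
  then have "AE x in M. g x - f x = 0"
    using assms(1-3) by (subst (asm) integral_nonneg_eq_0_iff_AE) (auto elim!: eventually_mono)
  then show ?thesis by eventually_elim simp
qed

text \<open>For nonnegative values the larger one dominates \<open>|f - g|\<close>, so
  \<open>|f - g|^p + min(f, g)^p \<le> f^p + g^p\<close>. Integrating leaves at most
  \<open>(2 - 2 powr p) * ?I \<le> 0\<close> for the minimum, so the supports of \<open>f\<close>
  and \<open>g\<close> are almost disjoint. Nonempty supports of nondecreasing functions reach up to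
  \<open>1\<close> and would overlap, so one function vanishes, and the norms are equal.\<close>

lemma zero_not_midpoint:
  assumes p: "p \<ge> 1" and f: "quantile_fun p f" and g: "quantile_fun p g"
    and eq: "pcost p f (\<lambda>_. 0) = pcost p g (\<lambda>_. 0)"
    and mid: "pcost p f g = 2 powr p * pcost p f (\<lambda>_. 0)"
  shows "pcost p f (\<lambda>_. 0) = 0"
proof -
  let ?I = "pcost p f (\<lambda>_. 0)"
  note [measurable] = f[THEN quantile_funD(1)] g[THEN quantile_funD(1)]
  note int = f[THEN quantile_funD(2)] g[THEN quantile_funD(2)] integrable_pcost[OF f g p]
  have pt: "\<bar>f \<omega> - g \<omega>\<bar> powr p + min (f \<omega>) (g \<omega>) powr p \<le> f \<omega> powr p + g \<omega> powr p"
    if "\<omega> \<in> space unit_ivl" for \<omega>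
  proof -
    have *: "0 \<le> f \<omega>" "0 \<le> g \<omega>" using that quantile_funD(3)[OF f] quantile_funD(3)[OF g] by auto
    then have "\<bar>f \<omega> - g \<omega>\<bar> powr p \<le> max (f \<omega>) (g \<omega>) powr p"
      using p by (intro powr_mono2) auto
    then show ?thesis by (auto simp: min_def max_def split: if_splits)
  qed
  have intm: "integrable unit_ivl (\<lambda>\<omega>. min (f \<omega>) (g \<omega>) powr p)"
    by (rule Bochner_Integration.integrable_bound[OF int(1)])
      (use p quantile_funD(3)[OF f] quantile_funD(3)[OF g] in \<open>auto intro!: AE_I2 powr_mono2\<close>)
  have "(\<integral>\<omega>. \<bar>f \<omega> - g \<omega>\<bar> powr p + min (f \<omega>) (g \<omega>) powr p \<partial>unit_ivl)
      \<le> (\<integral>\<omega>. f \<omega> powr p + g \<omega> powr p \<partial>unit_ivl)"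
    by (rule integral_mono) (use int intm pt in auto)
  then have "2 powr p * ?I + (\<integral>\<omega>. min (f \<omega>) (g \<omega>) powr p \<partial>unit_ivl) \<le> 2 * ?I"
    using int intm eq mid by (simp add: pcost_zero_right[OF f] pcost_zero_right[OF g] pcost_def[of p f g])
  moreover have "2 * ?I \<le> 2 powr p * ?I"
    using p powr_mono[of 1 p 2] by (intro mult_right_mono pcost_nonneg) auto
  ultimately have "(\<integral>\<omega>. min (f \<omega>) (g \<omega>) powr p \<partial>unit_ivl) \<le> 0" by simp
  then have "(\<integral>\<omega>. min (f \<omega>) (g \<omega>) powr p \<partial>unit_ivl) = 0"
    by (intro antisym) auto
  then have min0: "AE \<omega> in unit_ivl. min (f \<omega>) (g \<omega>) = 0"
    by (subst (asm) integral_nonneg_eq_0_iff_AE[OF intm]) auto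
  show ?thesis
  proof (cases "\<exists>\<omega>1\<in>{0<..<1}. f \<omega>1 > 0")
    case True
    then obtain \<omega>1 where \<omega>1: "0 < \<omega>1" "\<omega>1 < 1" "f \<omega>1 > 0" by auto
    have "g \<omega> = 0" if \<omega>: "0 < \<omega>" "\<omega> < 1" for \<omega>
    proof -
      obtain \<omega>' where \<omega>': "max \<omega> \<omega>1 < \<omega>'" "\<omega>' < 1" "min (f \<omega>') (g \<omega>') = 0"
        using AE_unit_ivl_obtain[OF min0, of "max \<omega> \<omega>1" 1] \<omega> \<omega>1
        by (metis less_eq_real_def max.coboundedI1 max_less_iff_conj order_refl)
      then have "f \<omega>' > 0" using quantile_funD(4)[OF f, of \<omega>1 \<omega>'] \<omega>1 by auto
      then have "g \<omega>' = 0" using \<omega>' by (auto simp: min_def split: if_splits)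
      then show ?thesis using quantile_funD(4)[OF g, of \<omega> \<omega>'] quantile_funD(3)[OF g, of \<omega>] \<omega> \<omega>' by auto
    qed
    then have "pcost p g (\<lambda>_. 0) = 0"
      by (subst pcost_eq_0_iff[OF g quantile_fun_zero p]) (auto intro!: AE_I2)
    then show ?thesis using eq by simp
  next
    case False
    then have "AE \<omega> in unit_ivl. f \<omega> = 0"
      using quantile_funD(3)[OF f] by (intro AE_I2) (auto intro!: antisym simp: not_less)
    then show ?thesis
      by (subst pcost_eq_0_iff[OF f quantile_fun_zero p])
  qed
qed

text \<open>A function that is not a step takes two different positive values to the right of the
  infimum \<open>\<omega>0\<close> of its support, and the smaller one is the level
  \<open>a\<close>. It cuts \<open>f\<close> into a low and a high part, each visible on an
  interval.\<close>

lemma not_ae_stepE: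
  assumes f: "quantile_fun p f" and "\<not> ae_step f"
  obtains a \<omega>0 \<omega>1 \<omega>2 where "0 < a" "0 \<le> \<omega>0" "\<omega>0 < \<omega>1" "\<omega>1 < 1" "0 \<le> \<omega>2" "\<omega>2 < 1"
    "\<And>\<omega>. \<omega>0 < \<omega> \<Longrightarrow> \<omega> < \<omega>1 \<Longrightarrow> 0 < f \<omega> \<and> f \<omega> \<le> a"
    "\<And>\<omega>. \<omega>2 < \<omega> \<Longrightarrow> \<omega> < 1 \<Longrightarrow> a < f \<omega>"
proof -
  define S where "S = {\<omega>. 0 < \<omega> \<and> \<omega> < 1 \<and> f \<omega> > 0}"
  have "S \<noteq> {}"
  proof
    assume "S = {}"
    then have "AE \<omega> in unit_ivl. f \<omega> = step 0 0 \<omega>"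
      using quantile_funD(3)[OF f] by (intro AE_I2) (force simp: S_def step_def)
    then show False using assms(2) unfolding ae_step_def by (auto intro!: exI[of _ "0::real"])
  qed
  have bdd: "bdd_below S" by (rule bdd_belowI[of _ 0]) (auto simp: S_def)
  define \<omega>0 where "\<omega>0 = Inf S"
  obtain z where z: "z \<in> S" using \<open>S \<noteq> {}\<close> by auto
  have "\<omega>0 \<le> z" unfolding \<omega>0_def by (rule cInf_lower[OF z bdd])
  then have \<omega>01: "\<omega>0 < 1" using z by (auto simp: S_def)
  have \<omega>00: "0 \<le> \<omega>0" unfolding \<omega>0_def by (rule cInf_greatest[OF \<open>S \<noteq> {}\<close>]) (auto simp: S_def)
  have pos: "0 < f \<omega>" if "\<omega>0 < \<omega>" "\<omega> < 1" for \<omega>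
  proof -
    obtain w where "w \<in> S" "w < \<omega>" using cInf_lessD[OF \<open>S \<noteq> {}\<close>, of \<omega>] \<open>\<omega>0 < \<omega>\<close> unfolding \<omega>0_def by blast
    then show ?thesis using quantile_funD(4)[OF f, of w \<omega>] that by (auto simp: S_def)
  qed
  have zero: "f \<omega> = 0" if "0 < \<omega>" "\<omega> < \<omega>0" for \<omega>
  proof -
    have "\<omega> \<notin> S" using that cInf_lower[OF _ bdd, of \<omega>] by (auto simp: \<omega>0_def)
    then show ?thesis using quantile_funD(3)[OF f, of \<omega>] that \<omega>01 by (auto simp: S_def)
  qed
  have "\<exists>\<omega>1 \<omega>2. \<omega>0 < \<omega>1 \<and> \<omega>1 < 1 \<and> \<omega>0 < \<omega>2 \<and> \<omega>2 < 1 \<and> f \<omega>1 < f \<omega>2"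
  proof (rule ccontr)
    assume *: "\<not> ?thesis"
    define m where "m = (\<omega>0 + 1) / 2"
    have m: "\<omega>0 < m" "m < 1" using \<omega>01 by (auto simp: m_def)
    have const: "f \<omega> = f m" if "\<omega>0 < \<omega>" "\<omega> < 1" for \<omega>
      using * that m by (meson linorder_neqE_linordered_idom)
    \<comment> \<open>The value of \<open>f\<close> at \<open>\<omega>0\<close> itself is not
      controlled: the support may or may not contain its infimum.\<close>
    have "AE \<omega> in unit_ivl. \<omega> \<noteq> \<omega>0"
      using AE_lborel_singleton[of \<omega>0] by (intro AE_lborel_imp_unit_ivl)
    then have "AE \<omega> in unit_ivl. f \<omega> = step \<omega>0 (f m) \<omega>"
      using AE_space
    proof eventually_elim
      case (elim \<omega>)
      then show ?case using const[of \<omega>] zero[of \<omega>] by (auto simp: step_def)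
    qed
    then show False
      using assms(2) \<omega>00 \<omega>01 pos[OF m] unfolding ae_step_def by (metis less_imp_le)
  qed
  then obtain \<omega>1 \<omega>2 where w: "\<omega>0 < \<omega>1" "\<omega>1 < 1" "\<omega>0 < \<omega>2" "\<omega>2 < 1" "f \<omega>1 < f \<omega>2" by blast
  show thesis
  proof (rule that[of "f \<omega>1" \<omega>0 \<omega>1 \<omega>2])
    fix \<omega> assume "\<omega>0 < \<omega>" "\<omega> < \<omega>1"
    then show "0 < f \<omega> \<and> f \<omega> \<le> f \<omega>1"
      using pos[of \<omega>] quantile_funD(4)[OF f, of \<omega> \<omega>1] w \<omega>00 by auto
  next
    fix \<omega> assume "\<omega>2 < \<omega>" "\<omega> < 1"
    then show "f \<omega>1 < f \<omega>" using quantile_funD(4)[OF f, of \<omega>2 \<omega>] w \<omega>00 by auto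
  qed (use w pos \<omega>00 in auto)
qed

subsection \<open>Metric characterisation of step functions\<close>

text \<open>The two conditions put \<open>h\<close> halfway between \<open>k\<close> and
  \<open>k'\<close>. Their sum is equality in the integrated form of \<open>abs_add_powr_le\<close>
  for \<open>a = k - h\<close> and \<open>b = h - k'\<close>, and the equality case gives
  \<open>a = b\<close> almost everywhere.\<close>

lemma midpoint_AE_eq:
  assumes p: "p > 1" and k: "quantile_fun p k" and h: "quantile_fun p h" and k': "quantile_fun p k'"
    and "2 powr p * pcost p k h = pcost p k k'" "2 powr p * pcost p h k' = pcost p k k'"
  shows "AE \<omega> in unit_ivl. k \<omega> + k' \<omega> = 2 * h \<omega>"
proof -
  have p1: "p \<ge> 1" using p by simp
  note int = integrable_pcost[OF k h p1] integrable_pcost[OF h k' p1] integrable_pcost[OF k k' p1]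
  have "AE \<omega> in unit_ivl. 2 * \<bar>k \<omega> - k' \<omega>\<bar> powr p =
      2 powr p * (\<bar>k \<omega> - h \<omega>\<bar> powr p + \<bar>h \<omega> - k' \<omega>\<bar> powr p)"
  proof (rule integral_eq_imp_AE_eq)
    show "AE \<omega> in unit_ivl. 2 * \<bar>k \<omega> - k' \<omega>\<bar> powr p \<le>
        2 powr p * (\<bar>k \<omega> - h \<omega>\<bar> powr p + \<bar>h \<omega> - k' \<omega>\<bar> powr p)"
      using abs_add_powr_le[OF p1, of "k \<omega> - h \<omega>" "h \<omega> - k' \<omega>" for \<omega>] by (intro AE_I2) simp
    show "(\<integral>\<omega>. 2 powr p * (\<bar>k \<omega> - h \<omega>\<bar> powr p + \<bar>h \<omega> - k' \<omega>\<bar> powr p) \<partial>unit_ivl)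
        \<le> (\<integral>\<omega>. 2 * \<bar>k \<omega> - k' \<omega>\<bar> powr p \<partial>unit_ivl)"
      using assms(5,6) int by (simp add: pcost_def distrib_left)
  qed (use int in auto)
  then show ?thesis
  proof eventually_elim
    case (elim \<omega>)
    then have "k \<omega> - h \<omega> = h \<omega> - k' \<omega>" by (intro abs_add_powr_eqD[OF p]) simp
    then show ?case by simp
  qed
qed

lemma pcost_step_zero:
  assumes "0 \<le> c" "c < 1" "0 \<le> s"
  shows "pcost p (step c s) (\<lambda>_. 0) = (1 - c) * s powr p"
proof -
  have "pcost p (step c s) (\<lambda>_. 0) = (\<integral>\<omega>. indicator {c<..<1} \<omega> * s powr p \<partial>unit_ivl)"
    unfolding pcost_zero_right[OF quantile_fun_step[OF assms(3)]]
    by (intro Bochner_Integration.integral_cong) (auto simp: step_def)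
  also have "\<dots> = (1 - c) * s powr p"
    using assms measure_unit_ivl_Ioo[of c] by (simp add: sets_unit_ivl Int_absorb2 subset_iff)
  finally show ?thesis .
qed

text \<open>Two nondecreasing functions with constant sum on \<open>(c, 1)\<close> are both constant
  there, and nonnegative functions with sum \<open>0\<close> vanish. So a step splits only into
  multiples of itself.\<close>

lemma ae_step_complement:
  assumes k: "quantile_fun p k" and k': "quantile_fun p k'" and c: "0 \<le> c" "c < 1"
    and sum: "AE \<omega> in unit_ivl. k \<omega> + k' \<omega> = 2 * step c s \<omega>"
  shows "\<exists>t\<ge>0. AE \<omega> in unit_ivl. k \<omega> = step c t \<omega>"
proof -
  obtain w where w: "c < w" "w < 1" "k w + k' w = 2 * step c s w"
    using AE_unit_ivl_obtain[OF sum, of c 1] c by auto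
  have "AE \<omega> in unit_ivl. k \<omega> = step c (k w) \<omega>"
    using sum AE_space
  proof eventually_elim
    case (elim \<omega>)
    then have \<omega>: "0 < \<omega>" "\<omega> < 1" by auto
    note nn = quantile_funD(3)[OF k \<omega>] quantile_funD(3)[OF k' \<omega>]
    show ?case
    proof (cases "c < \<omega>")
      case True
      then have "k \<omega> + k' \<omega> = k w + k' w" using elim w by (simp add: step_def)
      then have "k \<omega> = k w"
        using quantile_funD(4)[OF k, of \<omega> w] quantile_funD(4)[OF k', of \<omega> w]
          quantile_funD(4)[OF k, of w \<omega>] quantile_funD(4)[OF k', of w \<omega>] w \<omega> c
        by (cases "\<omega> \<le> w") auto
      then show ?thesis using True by (simp add: step_def)
    next
      case False
      then show ?thesis using elim nn by (simp add: step_def)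
    qed
  qed
  then show ?thesis using quantile_funD(3)[OF k, of w] w c by auto
qed

text \<open>For \<open>p > 1\<close> the next two lemmas characterise step functions metrically as the extreme rays of
  the cone: all points having \<open>h\<close> as a midpoint with some other point lie on one ray, so that they
  are determined by their norm. For \<open>p = 1\<close> midpoints are far from unique, and
  \<open>nonstep_lattice\<close> and \<open>step_join_irreducible\<close> use the order instead, which is metric: \<open>k \<le> h\<close> iff
  \<open>k\<close> lies between \<open>0\<close> and \<open>h\<close>.\<close>

lemma step_midpoints_unique:
  assumes p: "p > 1" and q: "quantile_fun p h" "quantile_fun p k1" "quantile_fun p k1'"
      "quantile_fun p k2" "quantile_fun p k2'"
    and h: "ae_step h"
    and 1: "2 powr p * pcost p k1 h = pcost p k1 k1'" "2 powr p * pcost p h k1' = pcost p k1 k1'"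
    and 2: "2 powr p * pcost p k2 h = pcost p k2 k2'" "2 powr p * pcost p h k2' = pcost p k2 k2'"
    and eq: "pcost p k1 (\<lambda>_. 0) = pcost p k2 (\<lambda>_. 0)"
  shows "pcost p k1 k2 = 0"
proof -
  obtain c s where c: "0 \<le> c" "c < 1" "0 \<le> s" and hs: "AE \<omega> in unit_ivl. h \<omega> = step c s \<omega>"
    using h unfolding ae_step_def by blast
  have "AE \<omega> in unit_ivl. k1 \<omega> + k1' \<omega> = 2 * step c s \<omega>"
    using midpoint_AE_eq[OF p q(2,1,3) 1] hs by eventually_elim simp
  then obtain t1 where t1: "t1 \<ge> 0" "AE \<omega> in unit_ivl. k1 \<omega> = step c t1 \<omega>"
    using ae_step_complement[OF q(2,3) c(1,2)] by blast
  have "AE \<omega> in unit_ivl. k2 \<omega> + k2' \<omega> = 2 * step c s \<omega>"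
    using midpoint_AE_eq[OF p q(4,1,5) 2] hs by eventually_elim simp
  then obtain t2 where t2: "t2 \<ge> 0" "AE \<omega> in unit_ivl. k2 \<omega> = step c t2 \<omega>"
    using ae_step_complement[OF q(4,5) c(1,2)] by blast
  have "pcost p k1 (\<lambda>_. 0) = (1 - c) * t1 powr p"
    using pcost_cong_AE[OF q(2) quantile_fun_step[OF t1(1)] quantile_fun_zero quantile_fun_zero t1(2)]
      pcost_step_zero[OF c(1,2) t1(1)] by simp
  moreover have "pcost p k2 (\<lambda>_. 0) = (1 - c) * t2 powr p"
    using pcost_cong_AE[OF q(4) quantile_fun_step[OF t2(1)] quantile_fun_zero quantile_fun_zero t2(2)]
      pcost_step_zero[OF c(1,2) t2(1)] by simp
  ultimately have "t1 powr p = t2 powr p" using eq c by simp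
  then have "t1 = t2" using t1(1) t2(1) p powr_less_mono2[of p t1 t2] powr_less_mono2[of p t2 t1]
    by (cases t1 t2 rule: linorder_cases) auto
  have "AE \<omega> in unit_ivl. k1 \<omega> = k2 \<omega>"
    using t1(2) t2(2) by eventually_elim (simp add: \<open>t1 = t2\<close>)
  then show ?thesis using pcost_eq_0_iff[OF q(2,4)] p by simp
qed

lemma nonstep_midpoints:
  assumes p: "p > 1" and f: "quantile_fun p f" and ns: "\<not> ae_step f"
  obtains k1 k1' k2 k2' where "quantile_fun p k1" "quantile_fun p k1'"
      "quantile_fun p k2" "quantile_fun p k2'"
    "2 powr p * pcost p k1 f = pcost p k1 k1'" "2 powr p * pcost p f k1' = pcost p k1 k1'"
    "2 powr p * pcost p k2 f = pcost p k2 k2'" "2 powr p * pcost p f k2' = pcost p k2 k2'"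
    "pcost p k1 (\<lambda>_. 0) = pcost p k2 (\<lambda>_. 0)" "pcost p k1 k2 \<noteq> 0"
proof -
  obtain a \<omega>0 \<omega>1 \<omega>2 where a: "0 < a" and \<omega>: "0 \<le> \<omega>0" "\<omega>0 < \<omega>1" "\<omega>1 < 1" "0 \<le> \<omega>2" "\<omega>2 < 1"
    and low: "\<And>\<omega>. \<omega>0 < \<omega> \<Longrightarrow> \<omega> < \<omega>1 \<Longrightarrow> 0 < f \<omega> \<and> f \<omega> \<le> a"
    and high: "\<And>\<omega>. \<omega>2 < \<omega> \<Longrightarrow> \<omega> < 1 \<Longrightarrow> a < f \<omega>"
    using not_ae_stepE[OF f ns] by metis
  have p1: "p \<ge> 1" using p by simp
  \<comment> \<open>Cutting at the level \<open>a\<close> splits \<open>f\<close> into two members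
    of the cone that are not proportional: on \<open>(\<omega>0, \<omega>1)\<close>,
    \<open>u\<close> is positive and \<open>v\<close> vanishes, but \<open>v\<close> is not
    null.\<close>
  define u where "u \<omega> = min (f \<omega>) a" for \<omega>
  define v where "v \<omega> = max (f \<omega> - a) 0" for \<omega>
  note fD = quantile_funD(3,4)[OF f]
  have uv: "u \<omega> + v \<omega> = f \<omega>" for \<omega> by (auto simp: u_def v_def)
  have qf: "quantile_fun p (\<lambda>\<omega>. x * u \<omega> + y * v \<omega>)" if "0 \<le> x" "x \<le> 2" "0 \<le> y" "y \<le> 2" for x y
  proof (rule quantile_fun_dominated[OF f p1])
    show "mono_on {0<..<1} (\<lambda>\<omega>. x * u \<omega> + y * v \<omega>)"
      using that fD(2) by (auto intro!: mono_onI add_mono mult_left_mono simp: u_def v_def intro: min.mono max.mono)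
    fix \<omega> :: real assume "0 < \<omega>" "\<omega> < 1"
    then have "0 \<le> u \<omega>" "0 \<le> v \<omega>" using fD(1) a by (auto simp: u_def v_def)
    then have "0 \<le> x * u \<omega>" "0 \<le> y * v \<omega>" "x * u \<omega> \<le> 2 * u \<omega>" "y * v \<omega> \<le> 2 * v \<omega>"
      using that by (auto intro: mult_right_mono)
    then show "0 \<le> x * u \<omega> + y * v \<omega>" "x * u \<omega> + y * v \<omega> \<le> 2 * f \<omega>"
      using uv[of \<omega>] by auto
  qed
  \<comment> \<open>The two combinations are mirror images in \<open>f = u + v\<close>, so
    \<open>f\<close> is their midpoint.\<close>
  have mid: "2 powr p * pcost p (\<lambda>\<omega>. x * u \<omega> + y * v \<omega>) f =
        pcost p (\<lambda>\<omega>. x * u \<omega> + y * v \<omega>) (\<lambda>\<omega>. (2 - x) * u \<omega> + (2 - y) * v \<omega>)"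
      "2 powr p * pcost p f (\<lambda>\<omega>. (2 - x) * u \<omega> + (2 - y) * v \<omega>) =
        pcost p (\<lambda>\<omega>. x * u \<omega> + y * v \<omega>) (\<lambda>\<omega>. (2 - x) * u \<omega> + (2 - y) * v \<omega>)" for x y
  proof -
    have e: "2 powr p * \<bar>z\<bar> powr p = \<bar>2 * z\<bar> powr p" for z :: real by (simp add: abs_mult powr_mult)
    show "2 powr p * pcost p (\<lambda>\<omega>. x * u \<omega> + y * v \<omega>) f =
        pcost p (\<lambda>\<omega>. x * u \<omega> + y * v \<omega>) (\<lambda>\<omega>. (2 - x) * u \<omega> + (2 - y) * v \<omega>)"
      unfolding pcost_def integral_mult_right_zero[symmetric] e
      by (intro Bochner_Integration.integral_cong refl arg_cong[where f = "\<lambda>z. \<bar>z\<bar> powr p"])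
        (simp add: uv[symmetric] algebra_simps)
    show "2 powr p * pcost p f (\<lambda>\<omega>. (2 - x) * u \<omega> + (2 - y) * v \<omega>) =
        pcost p (\<lambda>\<omega>. x * u \<omega> + y * v \<omega>) (\<lambda>\<omega>. (2 - x) * u \<omega> + (2 - y) * v \<omega>)"
      unfolding pcost_def integral_mult_right_zero[symmetric] e
      by (intro Bochner_Integration.integral_cong refl arg_cong[where f = "\<lambda>z. \<bar>z\<bar> powr p"])
        (simp add: uv[symmetric] algebra_simps)
  qed
  have q1: "quantile_fun p u" and q2: "quantile_fun p v"
    using qf[of 1 0] qf[of 0 1] by simp_all
  define U where "U = pcost p u (\<lambda>_. 0)"
  define V where "V = pcost p v (\<lambda>_. 0)"
  have scale: "pcost p (\<lambda>\<omega>. x * w \<omega>) (\<lambda>_. 0) = x powr p * pcost p w (\<lambda>_. 0)" if "0 \<le> x" for x w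
    unfolding pcost_def integral_mult_right_zero[symmetric] using that by (simp add: abs_mult powr_mult)
  have "U \<noteq> 0"
  proof
    assume "U = 0"
    then have "AE \<omega> in unit_ivl. u \<omega> = 0"
      using pcost_eq_0_iff[OF q1 quantile_fun_zero p1] by (simp add: U_def)
    from AE_unit_ivl_obtain[OF this \<omega>(1,2)] \<omega> obtain z where "\<omega>0 < z" "z < \<omega>1" "u z = 0" by auto
    then show False using low[of z] a by (auto simp: u_def min_def split: if_splits)
  qed
  have "V \<noteq> 0"
  proof
    assume "V = 0"
    then have "AE \<omega> in unit_ivl. v \<omega> = 0"
      using pcost_eq_0_iff[OF q2 quantile_fun_zero p1] by (simp add: V_def)
    from AE_unit_ivl_obtain[OF this \<omega>(4,5)] obtain z where "\<omega>2 < z" "z < 1" "v z = 0" by auto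
    then show False using high[of z] by (auto simp: v_def max_def split: if_splits)
  qed
  have UV: "U > 0" "V > 0" using \<open>U \<noteq> 0\<close> \<open>V \<noteq> 0\<close> pcost_nonneg[of p u "\<lambda>_. 0"] pcost_nonneg[of p v "\<lambda>_. 0"]
    by (auto simp: U_def V_def)
  \<comment> \<open>Chosen to equalise the norms:
    \<open>x powr p * U = y powr p * V = min U V\<close>. Dividing by the maximum keeps
    \<open>x\<close> and \<open>y\<close> at most \<open>1\<close>, so that the coefficients
    \<open>2 - x\<close> and \<open>2 - y\<close> of the mirror images stay nonnegative.\<close>
  define x where "x = (V / max U V) powr (1 / p)"
  define y where "y = (U / max U V) powr (1 / p)"
  have xp: "x powr p = V / max U V" "y powr p = U / max U V"
    using p UV by (auto simp: x_def y_def powr_powr)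
  have pos: "0 < x" "0 < y" using UV by (auto simp: x_def y_def)
  have "x \<le> 1" "y \<le> 1"
    using UV p unfolding x_def y_def by (auto intro!: powr_le1 simp: divide_le_eq_1)
  with pos have xy: "0 \<le> x" "x \<le> 2" "0 \<le> y" "y \<le> 2" by auto
  show thesis
  proof (rule that)
    show "quantile_fun p (\<lambda>\<omega>. x * u \<omega> + 0 * v \<omega>)" "quantile_fun p (\<lambda>\<omega>. (2 - x) * u \<omega> + (2 - 0) * v \<omega>)"
      "quantile_fun p (\<lambda>\<omega>. 0 * u \<omega> + y * v \<omega>)" "quantile_fun p (\<lambda>\<omega>. (2 - 0) * u \<omega> + (2 - y) * v \<omega>)"
      using xy qf[of x 0] qf[of "2 - x" 2] qf[of 0 y] qf[of 2 "2 - y"] by simp_all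
    show "pcost p (\<lambda>\<omega>. x * u \<omega> + 0 * v \<omega>) (\<lambda>_. 0) = pcost p (\<lambda>\<omega>. 0 * u \<omega> + y * v \<omega>) (\<lambda>_. 0)"
      using scale[OF xy(1), of u] scale[OF xy(3), of v] by (simp add: xp U_def[symmetric] V_def[symmetric])
    show "pcost p (\<lambda>\<omega>. x * u \<omega> + 0 * v \<omega>) (\<lambda>\<omega>. 0 * u \<omega> + y * v \<omega>) \<noteq> 0"
    proof
      assume "pcost p (\<lambda>\<omega>. x * u \<omega> + 0 * v \<omega>) (\<lambda>\<omega>. 0 * u \<omega> + y * v \<omega>) = 0"
      then have "AE \<omega> in unit_ivl. x * u \<omega> = y * v \<omega>"
        using pcost_eq_0_iff[OF qf[of x 0] qf[of 0 y] p1] xy by simp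
      from AE_unit_ivl_obtain[OF this \<omega>(1,2)] \<omega> obtain z where "\<omega>0 < z" "z < \<omega>1" "x * u z = y * v z" by auto
      then show False using low[of z] a pos by (auto simp: u_def v_def min_def max_def split: if_splits)
    qed
  qed (rule mid)+
qed

lemma pcost_add_eq:
  assumes "quantile_fun p f" "quantile_fun p g" "quantile_fun p f'" "quantile_fun p g'" "p \<ge> 1"
    and "\<And>\<omega>. 0 < \<omega> \<Longrightarrow> \<omega> < 1 \<Longrightarrow>
      \<bar>f \<omega> - g \<omega>\<bar> powr p + \<bar>f' \<omega> - g' \<omega>\<bar> powr p = \<bar>f'' \<omega> - g'' \<omega>\<bar> powr p"
  shows "pcost p f g + pcost p f' g' = pcost p f'' g''"
proof -
  have "pcost p f g + pcost p f' g' = (\<integral>\<omega>. \<bar>f \<omega> - g \<omega>\<bar> powr p + \<bar>f' \<omega> - g' \<omega>\<bar> powr p \<partial>unit_ivl)"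
    unfolding pcost_def using assms by (intro Bochner_Integration.integral_add[symmetric] integrable_pcost)
  also have "\<dots> = pcost p f'' g''"
    unfolding pcost_def using assms(6) by (intro Bochner_Integration.integral_cong) auto
  finally show ?thesis .
qed

lemma nonstep_lattice:
  assumes f: "quantile_fun 1 f" and ns: "\<not> ae_step f"
  obtains k1 k2 where "quantile_fun 1 k1" "quantile_fun 1 k2"
    "pcost 1 k1 (\<lambda>_. 0) + pcost 1 k1 f = pcost 1 f (\<lambda>_. 0)"
    "pcost 1 k2 (\<lambda>_. 0) + pcost 1 k2 f = pcost 1 f (\<lambda>_. 0)"
    "pcost 1 k1 f + pcost 1 k2 f = pcost 1 k1 k2"
    "pcost 1 k1 f \<noteq> 0" "pcost 1 k2 f \<noteq> 0"
proof -
  obtain a \<omega>0 \<omega>1 \<omega>2 where a: "0 < a" and \<omega>: "0 \<le> \<omega>0" "\<omega>0 < \<omega>1" "\<omega>1 < 1" "0 \<le> \<omega>2" "\<omega>2 < 1"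
    and low: "\<And>\<omega>. \<omega>0 < \<omega> \<Longrightarrow> \<omega> < \<omega>1 \<Longrightarrow> 0 < f \<omega> \<and> f \<omega> \<le> a"
    and high: "\<And>\<omega>. \<omega>2 < \<omega> \<Longrightarrow> \<omega> < 1 \<Longrightarrow> a < f \<omega>"
    using not_ae_stepE[OF f ns] by metis
  \<comment> \<open>At each point \<open>f\<close> is the larger of \<open>k1\<close> and
    \<open>k2\<close>, so it lies metrically between them although neither equals \<open>f\<close>.
    Above the level, \<open>k2\<close> keeps the full value of \<open>f\<close>; the excess
    \<open>f - a\<close> would not recover \<open>f\<close> as a maximum.\<close>
  define k1 where "k1 \<omega> = min (f \<omega>) a" for \<omega>
  define k2 where "k2 \<omega> = (if a < f \<omega> then f \<omega> else 0)" for \<omega>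
  note fD = quantile_funD(3,4)[OF f]
  have q1: "quantile_fun 1 k1"
    by (rule quantile_fun_dominated[OF f])
      (use a fD in \<open>auto simp: k1_def mono_on_def min_le_iff_disj intro!: min.mono\<close>)
  have q2: "quantile_fun 1 k2"
  proof (rule quantile_fun_dominated[OF f])
    show "mono_on {0<..<1} k2"
    proof (rule mono_onI)
      fix r s :: real assume "r \<in> {0<..<1}" "s \<in> {0<..<1}" "r \<le> s"
      then show "k2 r \<le> k2 s" using fD(2)[of r s] fD(1)[of s] by (auto simp: k2_def)
    qed
  qed (use a fD(1) in \<open>auto simp: k2_def\<close>)
  have sum1: "pcost 1 k1 (\<lambda>_. 0) + pcost 1 k1 f = pcost 1 f (\<lambda>_. 0)"
    by (rule pcost_add_eq) (use q1 q2 f quantile_fun_zero fD(1) a in \<open>auto simp: k1_def min_def\<close>)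
  have sum2: "pcost 1 k2 (\<lambda>_. 0) + pcost 1 k2 f = pcost 1 f (\<lambda>_. 0)"
    by (rule pcost_add_eq) (use q1 q2 f quantile_fun_zero fD(1) a in \<open>auto simp: k2_def\<close>)
  have sum3: "pcost 1 k1 f + pcost 1 k2 f = pcost 1 k1 k2"
    by (rule pcost_add_eq) (use q1 q2 f quantile_fun_zero fD(1) a in \<open>auto simp: k1_def k2_def min_def\<close>)
  have n1: "pcost 1 k1 f \<noteq> 0"
  proof
    assume "pcost 1 k1 f = 0"
    then have "AE \<omega> in unit_ivl. k1 \<omega> = f \<omega>" using pcost_eq_0_iff[OF q1 f] by simp
    from AE_unit_ivl_obtain[OF this \<omega>(4,5)] obtain z where "\<omega>2 < z" "z < 1" "k1 z = f z" by auto
    then show False using high[of z] by (auto simp: k1_def)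
  qed
  have n2: "pcost 1 k2 f \<noteq> 0"
  proof
    assume "pcost 1 k2 f = 0"
    then have "AE \<omega> in unit_ivl. k2 \<omega> = f \<omega>" using pcost_eq_0_iff[OF q2 f] by simp
    from AE_unit_ivl_obtain[OF this \<omega>(1,2)] \<omega> obtain z where "\<omega>0 < z" "z < \<omega>1" "k2 z = f z" by auto
    then show False using low[of z] by (auto simp: k2_def split: if_splits)
  qed
  show thesis by (rule that[OF q1 q2 sum1 sum2 sum3 n1 n2])
qed

text \<open>Equality in the integrated triangle inequality holds almost everywhere, and
  \<open>h = k + |k - h|\<close> excludes \<open>k > h\<close>.\<close>

lemma pcost_between_zero:
  assumes k: "quantile_fun 1 k" and h: "quantile_fun 1 h"
    and eq: "pcost 1 k (\<lambda>_. 0) + pcost 1 k h = pcost 1 h (\<lambda>_. 0)"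
  shows "AE \<omega> in unit_ivl. k \<omega> \<le> h \<omega>"
proof -
  note int = integrable_pcost[OF k h] integrable_pcost[OF k quantile_fun_zero] integrable_pcost[OF h quantile_fun_zero]
  have "AE \<omega> in unit_ivl. \<bar>h \<omega> - 0\<bar> powr 1 = \<bar>k \<omega> - 0\<bar> powr 1 + \<bar>k \<omega> - h \<omega>\<bar> powr 1"
    by (rule integral_eq_imp_AE_eq) (use int eq in \<open>auto simp: pcost_def\<close>)
  then show ?thesis
    using AE_space quantile_funD(3)[OF k] quantile_funD(3)[OF h]
    by (elim eventually_rev_mp, intro AE_I2) auto
qed

lemma step_join_irreducible:
  assumes q: "quantile_fun 1 h" "quantile_fun 1 k1" "quantile_fun 1 k2" and h: "ae_step h"
    and 1: "pcost 1 k1 (\<lambda>_. 0) + pcost 1 k1 h = pcost 1 h (\<lambda>_. 0)"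
    and 2: "pcost 1 k2 (\<lambda>_. 0) + pcost 1 k2 h = pcost 1 h (\<lambda>_. 0)"
    and 3: "pcost 1 k1 h + pcost 1 k2 h = pcost 1 k1 k2"
  shows "pcost 1 k1 h = 0 \<or> pcost 1 k2 h = 0"
proof (cases "pcost 1 k1 h = 0")
  case False
  obtain c s where c: "0 \<le> c" "c < 1" "0 \<le> s" and hs: "AE \<omega> in unit_ivl. h \<omega> = step c s \<omega>"
    using h unfolding ae_step_def by blast
  note int = integrable_pcost[OF q(2,1)] integrable_pcost[OF q(3,1)] integrable_pcost[OF q(2,3)]
  \<comment> \<open>Additivity in \<open>3\<close> puts \<open>h\<close> between \<open>k1\<close>
    and \<open>k2\<close> almost everywhere; as neither exceeds \<open>h\<close>, one of them must
    equal it.\<close>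
  have "AE \<omega> in unit_ivl. \<bar>k1 \<omega> - k2 \<omega>\<bar> powr 1 = \<bar>k1 \<omega> - h \<omega>\<bar> powr 1 + \<bar>k2 \<omega> - h \<omega>\<bar> powr 1"
    by (rule integral_eq_imp_AE_eq) (use int 3 in \<open>auto simp: pcost_def\<close>)
  then have all: "AE \<omega> in unit_ivl. k1 \<omega> \<le> step c s \<omega> \<and> k2 \<omega> \<le> step c s \<omega> \<and>
      (k1 \<omega> = step c s \<omega> \<or> k2 \<omega> = step c s \<omega>)"
    using pcost_between_zero[OF q(2,1) 1] pcost_between_zero[OF q(3,1) 2] hs
    by eventually_elim auto
  have "\<exists>w. c < w \<and> w < 1 \<and> k1 w < s"
  proof (rule ccontr)
    assume *: "\<not> ?thesis"
    have "AE \<omega> in unit_ivl. k1 \<omega> = h \<omega>"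
      using all hs AE_space
    proof eventually_elim
      case (elim \<omega>)
      then show ?case
        using * quantile_funD(3)[OF q(2), of \<omega>] by (cases "c < \<omega>") (auto simp: step_def intro!: antisym)
    qed
    then show False using pcost_eq_0_iff[OF q(2,1)] False by simp
  qed
  then obtain w where w: "c < w" "w < 1" "k1 w < s" by blast
  \<comment> \<open>By monotonicity \<open>k1\<close> stays below \<open>s\<close> on
    \<open>(c, w]\<close>. So \<open>k2\<close> takes the value \<open>s\<close> at points
    arbitrarily close to \<open>c\<close>, and hence is at least \<open>s\<close> on all of
    \<open>(c, 1)\<close>.\<close>
  have ge: "s \<le> k2 \<omega>" if \<omega>: "c < \<omega>" "\<omega> < 1" for \<omega>
  proof -
    obtain z where z: "c < z" "z < min \<omega> w" "k1 z \<le> step c s z \<and> k2 z \<le> step c s z \<and>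
        (k1 z = step c s z \<or> k2 z = step c s z)"
      by (rule AE_unit_ivl_obtain[OF all, of c "min \<omega> w"]) (use \<omega> w c in auto)
    have "k1 z \<le> k1 w" using quantile_funD(4)[OF q(2), of z w] z w c by auto
    then have "k2 z = s" using z w by (auto simp: step_def)
    then show ?thesis using quantile_funD(4)[OF q(3), of z \<omega>] z \<omega> c by auto
  qed
  have "AE \<omega> in unit_ivl. k2 \<omega> = h \<omega>"
    using all hs AE_space
  proof eventually_elim
    case (elim \<omega>)
    then show ?case
      using ge[of \<omega>] quantile_funD(3)[OF q(3), of \<omega>] by (cases "c < \<omega>") (auto simp: step_def intro!: antisym)
  qed
  then show ?thesis using pcost_eq_0_iff[OF q(3,1)] by simp
qed simp

subsection \<open>Rigidity of the cone\<close>

text \<open>In the coordinate \<open>t = - ln b\<close>, the quotient \<open>min / max\<close> is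
  the exponential of minus the distance. The claim is thus that a distance-preserving relation on
  the half-line \<open>t \<ge> 0\<close>, total on both sides, lies in the identity.\<close>

lemma ratio_preserving_eq:
  fixes S :: "real \<Rightarrow> real \<Rightarrow> bool"
  assumes dom: "\<And>b b'. S b b' \<Longrightarrow> 0 < b \<and> b \<le> 1 \<and> 0 < b' \<and> b' \<le> 1"
    and left: "\<And>b. 0 < b \<Longrightarrow> b \<le> 1 \<Longrightarrow> \<exists>b'. S b b'"
    and right: "\<And>b'. 0 < b' \<Longrightarrow> b' \<le> 1 \<Longrightarrow> \<exists>b. S b b'"
    and ratio: "\<And>b b' d d'. S b b' \<Longrightarrow> S d d' \<Longrightarrow> min b d / max b d = min b' d' / max b' d'"
    and "S b b'"
  shows "b = b'"
proof -
  obtain x where x: "S 1 x" using left[of 1] by auto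
  obtain y where y: "S y 1" using right[of 1] by auto
  have "y = x" using ratio[OF y x] dom[OF x] dom[OF y] by (simp add: min_def max_def split: if_splits)
  have x01: "0 < x" "x \<le> 1" using dom[OF x] by auto
  \<comment> \<open>Put \<open>t = - ln x\<close>. The end \<open>0\<close> is sent to
    \<open>t\<close>, and \<open>t\<close> to \<open>0\<close>. So \<open>2 * t\<close>, at distance
    \<open>t\<close> from \<open>t\<close>, is sent to distance \<open>t\<close> from
    \<open>0\<close>, that is to \<open>t\<close>, just like \<open>0\<close>. Hence
    \<open>2 * t = 0\<close>.\<close>
  then obtain w where w: "S (x * x) w" using left[of "x * x"] by (auto simp: mult_le_one)
  have xx: "x * x \<le> x" using x01 by (simp add: mult_left_le)
  have "w = x"
    using ratio[OF w y] xx x01 dom[OF w] by (simp add: \<open>y = x\<close> min_absorb1 max_absorb2)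
  then have "x * x = 1"
    using ratio[OF w x] xx x01 dom[OF w] by (simp add: min_absorb1 max_absorb2)
  then have "x = 1" using x01 xx by auto
  then show "b = b'"
    using ratio[OF \<open>S b b'\<close> x] dom[OF \<open>S b b'\<close>] by (simp add: min_absorb1 max_absorb2)
qed

section \<open>Distances between step functions of equal moment\<close>

lemma powr_gap_strict_antimono:
  fixes x y s p :: real
  assumes "p \<ge> 1" "0 \<le> x" "x < y" "y \<le> s"
  shows "(s - y) powr p - y powr p < (s - x) powr p - x powr p"
  using assms powr_less_mono2[of p x y] powr_less_mono2[of p "s - y" "s - x"] by simp

text \<open>Quantile function of the measure with mass \<open>1 - b\<close> at the origin, the remaining mass in one
  further point, and \<open>p\<close>-th moment \<open>V\<close>.\<close>

definition moment_step :: "real \<Rightarrow> real \<Rightarrow> real \<Rightarrow> real \<Rightarrow> real" where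
  "moment_step p V b = step (1 - b) ((V / b) powr (1 / p))"

lemma pcost_step_step:
  assumes "0 \<le> c" "c \<le> d" "d < 1" "0 \<le> s" "0 \<le> t" "p \<ge> 1"
  shows "pcost p (step c s) (step d t) = (d - c) * s powr p + (1 - d) * \<bar>s - t\<bar> powr p"
proof -
  have ind: "integrable unit_ivl (indicator {c<..d} :: real \<Rightarrow> real)"
      "integrable unit_ivl (indicator {d<..<1} :: real \<Rightarrow> real)"
    using assms by (auto intro!: integrable_real_indicator simp: sets_unit_ivl less_top[symmetric])
  have "pcost p (step c s) (step d t) = (\<integral>\<omega>. indicator {c<..d} \<omega> * s powr p + indicator {d<..<1} \<omega> * \<bar>s - t\<bar> powr p \<partial>unit_ivl)"
    unfolding pcost_def using assms
    by (intro Bochner_Integration.integral_cong) (auto simp: step_def indicator_def)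
  also have "\<dots> = measure unit_ivl {c<..d} * s powr p + measure unit_ivl {d<..<1} * \<bar>s - t\<bar> powr p"
    using ind assms by (subst Bochner_Integration.integral_add) (auto simp: Int_absorb2 subset_iff)
  also have "measure unit_ivl {c<..d} = d - c"
    using assms measure_unit_ivl_Ioc[of c d] by (cases "c = d") auto
  also have "measure unit_ivl {d<..<1} = 1 - d"
    using assms by (intro measure_unit_ivl_Ioo) auto
  finally show ?thesis .
qed

lemma pcost_moment_step:
  assumes "p \<ge> 1" "V > 0" "0 < b" "b \<le> d" "d \<le> 1"
  shows "pcost p (moment_step p V b) (moment_step p V d) =
    V * (1 + ((1 - (b / d) powr (1 / p)) powr p - ((b / d) powr (1 / p)) powr p))"
proof -
  \<comment> \<open>The ratio of the two heights: \<open>V = b * t^p = d * (z * t)^p\<close>. Masses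
    and heights scale together, so only \<open>b / d\<close> survives beside
    \<open>V\<close>.\<close>
  define z where "z = (b / d) powr (1 / p)"
  define t where "t = (V / b) powr (1 / p)"
  have d: "0 < d" using assms by auto
  have z: "0 \<le> z" "z \<le> 1" "z powr p = b / d"
    using assms d by (auto simp: z_def powr_powr intro!: powr_le1)
  have tp: "0 \<le> t" "t powr p = V / b" using assms by (auto simp: t_def powr_powr)
  have s: "(V / d) powr (1 / p) = z * t"
    using assms d by (simp add: z_def t_def powr_mult[symmetric])
  have "pcost p (moment_step p V d) (moment_step p V b) =
      ((1 - b) - (1 - d)) * (z * t) powr p + (1 - (1 - b)) * \<bar>z * t - t\<bar> powr p"
    unfolding moment_step_def s t_def[symmetric] using assms z tp
    by (intro pcost_step_step) auto
  also have "\<bar>z * t - t\<bar> = (1 - z) * t"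
    using mult_left_le_one_le[of t z] z tp by (simp add: algebra_simps)
  also have "((1 - b) - (1 - d)) * (z * t) powr p + (1 - (1 - b)) * ((1 - z) * t) powr p
      = V * (1 + ((1 - z) powr p - z powr p))"
  proof -
    have *: "(1 - b - (1 - d)) * (z * t) powr p = (d - b) * (b / d) * (V / b)"
      "(1 - (1 - b)) * ((1 - z) * t) powr p = b * (1 - z) powr p * (V / b)"
      using z tp by (simp_all add: powr_mult)
    show ?thesis unfolding * z(3) using assms d by (simp add: field_simps)
  qed
  finally show ?thesis by (simp add: z_def pcost_commute)
qed

lemma pcost_moment_step_min_max:
  assumes "p \<ge> 1" "V > 0" "0 < b" "b \<le> 1" "0 < d" "d \<le> 1"
  shows "pcost p (moment_step p V b) (moment_step p V d) =
    V * (1 + ((1 - (min b d / max b d) powr (1 / p)) powr p - ((min b d / max b d) powr (1 / p)) powr p))"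
  using pcost_moment_step[of p V b d] pcost_moment_step[of p V d b] assms
  by (cases "b \<le> d") (auto simp: min_def max_def pcost_commute)

text \<open>The bracket in the distance formula is strictly decreasing in the height ratio, by
  \<open>powr_gap_strict_antimono\<close> with \<open>s = 1\<close>; this holds even for
  \<open>p = 1\<close>.\<close>

lemma pcost_moment_step_inj:
  assumes p: "p \<ge> 1" and V: "V > 0"
    and b: "0 < b" "b \<le> 1" "0 < d" "d \<le> 1" "0 < b'" "b' \<le> 1" "0 < d'" "d' \<le> 1"
    and eq: "pcost p (moment_step p V b) (moment_step p V d) =
      pcost p (moment_step p V b') (moment_step p V d')"
  shows "min b d / max b d = min b' d' / max b' d'"
proof -
  define z where "z = (min b d / max b d) powr (1 / p)"
  define z' where "z' = (min b' d' / max b' d') powr (1 / p)"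
  have r: "0 < min b d / max b d" "min b d / max b d \<le> 1" "0 < min b' d' / max b' d'" "min b' d' / max b' d' \<le> 1"
    using b by (auto simp: min_def max_def)
  have "z \<le> 1" "z' \<le> 1"
    unfolding z_def z'_def using r p by (intro powr_le1; linarith?; simp)+
  then have z: "0 \<le> z" "z \<le> 1" "0 \<le> z'" "z' \<le> 1"
    by (auto simp: z_def z'_def)
  have "(1 - z) powr p - z powr p = (1 - z') powr p - z' powr p"
    using eq V pcost_moment_step_min_max[OF p V b(1-4)] pcost_moment_step_min_max[OF p V b(5-8)]
    by (simp add: z_def z'_def)
  then have "z = z'"
    using powr_gap_strict_antimono[OF p, of z z' 1] powr_gap_strict_antimono[OF p, of z' z 1] z
    by (cases z z' rule: linorder_cases) auto
  moreover have "(x powr (1 / p)) powr p = x" if "0 < x" for x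
    using that p by (simp add: powr_powr)
  ultimately show ?thesis unfolding z_def z'_def using r(1,3) by metis
qed

lemma ae_step_moment_step:
  assumes p: "p \<ge> 1" and f: "quantile_fun p f" "ae_step f" and V: "pcost p f (\<lambda>_. 0) = V" "V > 0"
  shows "\<exists>b. 0 < b \<and> b \<le> 1 \<and> (AE \<omega> in unit_ivl. f \<omega> = moment_step p V b \<omega>)"
proof -
  obtain c s where c: "0 \<le> c" "c < 1" "0 \<le> s" and fs: "AE \<omega> in unit_ivl. f \<omega> = step c s \<omega>"
    using f(2) unfolding ae_step_def by blast
  have "pcost p f (\<lambda>_. 0) = (1 - c) * s powr p"
    using pcost_cong_AE[OF f(1) quantile_fun_step[OF c(3)] quantile_fun_zero quantile_fun_zero fs]
      pcost_step_zero[OF c] by simp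
  then have "V / (1 - c) = s powr p" using V c by (simp add: field_simps)
  then have "step c s = moment_step p V (1 - c)"
    using c p by (simp add: moment_step_def powr_powr)
  then show ?thesis using fs c by (intro exI[of _ "1 - c"]) auto
qed

lemma quantile_fun_moment_step: "quantile_fun p (moment_step p V b)"
  unfolding moment_step_def by (rule quantile_fun_step) simp

lemma pcost_moment_step_zero:
  assumes "p \<ge> 1" "V > 0" "0 < b" "b \<le> 1"
  shows "pcost p (moment_step p V b) (\<lambda>_. 0) = V"
  unfolding moment_step_def using assms by (subst pcost_step_zero) (auto simp: powr_powr)

lemma ae_step_step: "0 \<le> c \<Longrightarrow> c < 1 \<Longrightarrow> 0 \<le> s \<Longrightarrow> ae_step (step c s)"
  unfolding ae_step_def by (intro exI[of _ c] exI[of _ s]) auto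

text \<open>The costs of \<open>q\<close> to \<open>step a s\<close> and \<open>step b s\<close>
  differ by the integral of \<open>|q - s|^p - q^p\<close> over \<open>(a, b]\<close>, which is
  therefore the same for \<open>q = f\<close> and \<open>q = g\<close>. If \<open>f b < g a\<close>,
  then \<open>f\<close> stays below \<open>g\<close> by a fixed gap on this interval, and the
  integrals differ.\<close>

lemma quantile_le_if_same_step_costs:
  assumes p: "p \<ge> 1" and f: "quantile_fun p f" and g: "quantile_fun p g"
    and eq: "\<And>c s. 0 \<le> c \<Longrightarrow> c < 1 \<Longrightarrow> 0 < s \<Longrightarrow> pcost p f (step c s) = pcost p g (step c s)"
    and ab: "0 < a" "a < b" "b < 1"
  shows "g a \<le> f b"
proof (rule ccontr)
  assume "\<not> g a \<le> f b"
  then have less: "f b < g a" by simp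
  \<comment> \<open>With this height all values of \<open>f\<close> and \<open>g\<close> on
    \<open>(a, b]\<close> lie in \<open>[0, s]\<close>, where the integrand is monotone in the
    value.\<close>
  define s where "s = g b"
  define \<delta> where "\<delta> = ((s - f b) powr p - f b powr p) - ((s - g a) powr p - g a powr p)"
  have gab: "g a \<le> s" using quantile_funD(4)[OF g, of a b] ab by (simp add: s_def)
  have fb: "0 \<le> f b" using quantile_funD(3)[OF f, of b] ab by simp
  have s: "0 < s" using gab less fb by simp
  have \<delta>: "0 < \<delta>" using powr_gap_strict_antimono[OF p fb less gab] by (simp add: \<delta>_def)
  have qs: "quantile_fun p (step c s)" for c using s by (intro quantile_fun_step) simp
  note int = integrable_pcost[OF f qs p] integrable_pcost[OF g qs p]
  let ?F = "\<lambda>\<omega>. (\<bar>f \<omega> - step a s \<omega>\<bar> powr p - \<bar>f \<omega> - step b s \<omega>\<bar> powr p) -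
      (\<bar>g \<omega> - step a s \<omega>\<bar> powr p - \<bar>g \<omega> - step b s \<omega>\<bar> powr p)"
  have "(\<integral>\<omega>. \<delta> * indicator {a<..b} \<omega> \<partial>unit_ivl) \<le> (\<integral>\<omega>. ?F \<omega> \<partial>unit_ivl)"
  proof (rule integral_mono)
    show "integrable unit_ivl ?F" using int by auto
    show "integrable unit_ivl (\<lambda>\<omega>. \<delta> * indicator {a<..b} \<omega>)"
      using ab by (auto intro!: integrable_real_indicator integrable_mult_right simp: sets_unit_ivl less_top[symmetric])
    fix \<omega> assume "\<omega> \<in> space unit_ivl"
    then have \<omega>: "0 < \<omega>" "\<omega> < 1" by auto
    show "\<delta> * indicator {a<..b} \<omega> \<le> ?F \<omega>"
    proof (cases "a < \<omega> \<and> \<omega> \<le> b")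
      case True
      note m = quantile_funD(3)[OF f \<omega>] quantile_funD(4)[OF f, of \<omega> b] quantile_funD(4)[OF g, of a \<omega>]
        quantile_funD(4)[OF g, of \<omega> b]
      have 1: "0 \<le> f \<omega>" "f \<omega> \<le> f b" "g a \<le> g \<omega>" "g \<omega> \<le> s" using m True ab by (auto simp: s_def)
      have "(s - f b) powr p - f b powr p \<le> (s - f \<omega>) powr p - f \<omega> powr p"
        using powr_gap_strict_antimono[OF p, of "f \<omega>" "f b" s] 1 less gab by (cases "f \<omega> = f b") auto
      moreover have "(s - g \<omega>) powr p - g \<omega> powr p \<le> (s - g a) powr p - g a powr p"
        using powr_gap_strict_antimono[OF p, of "g a" "g \<omega>" s] 1 less fb by (cases "g \<omega> = g a") auto
      moreover have "\<bar>f \<omega> - s\<bar> = s - f \<omega>" "\<bar>g \<omega> - s\<bar> = s - g \<omega>" "\<bar>f \<omega>\<bar> = f \<omega>" "\<bar>g \<omega>\<bar> = g \<omega>"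
        using 1 less gab fb by auto
      ultimately show ?thesis using True by (simp add: step_def \<delta>_def)
    qed (use ab in \<open>auto simp: step_def\<close>)
  qed
  also have "(\<integral>\<omega>. ?F \<omega> \<partial>unit_ivl) =
      (pcost p f (step a s) - pcost p f (step b s)) - (pcost p g (step a s) - pcost p g (step b s))"
    unfolding pcost_def using int by simp
  also have "\<dots> = 0" using eq[of a s] eq[of b s] ab s by simp
  finally have "\<delta> * (b - a) \<le> 0"
    using ab measure_unit_ivl_Ioc[of a b] by (simp add: Int_absorb2 subset_iff)
  then show False using \<delta> ab by (simp add: mult_le_0_iff)
qed

text \<open>At a continuity point of \<open>f\<close> the hypotheses squeeze \<open>g\<close>
  between the left and right limits of \<open>f\<close>, and a monotone function has only countably
  many discontinuities.\<close>

lemma quantile_AE_eq_if_interlaced: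
  assumes f: "mono_on {0<..<1} f"
    and fg: "\<And>a b. 0 < a \<Longrightarrow> a < b \<Longrightarrow> b < 1 \<Longrightarrow> g a \<le> f b"
    and gf: "\<And>a b. 0 < a \<Longrightarrow> a < b \<Longrightarrow> b < 1 \<Longrightarrow> f a \<le> g b"
  shows "AE \<omega> in unit_ivl. f \<omega> = (g \<omega> :: real)"
proof -
  let ?D = "{\<omega>\<in>{0<..<1}. \<not> isCont f \<omega>}"
  have "countable ?D" by (rule mono_on_ctble_discont_open[OF _ f]) simp
  then have "?D \<in> null_sets lborel"
    by (rule countable_imp_null_set_lborel)
  then have "AE \<omega> in lborel. \<omega> \<notin> ?D" by (rule AE_not_in)
  then have "AE \<omega> in unit_ivl. \<omega> \<notin> ?D" by (rule AE_lborel_imp_unit_ivl)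
  then show ?thesis using AE_space
  proof eventually_elim
    case (elim \<omega>)
    then have \<omega>: "0 < \<omega>" "\<omega> < 1" and c: "isCont f \<omega>" by auto
    have lim: "(f \<longlongrightarrow> f \<omega>) (at_right \<omega>)" "(f \<longlongrightarrow> f \<omega>) (at_left \<omega>)"
      using c by (auto simp: isCont_def intro: tendsto_within_subset)
    have "eventually (\<lambda>b. g \<omega> \<le> f b) (at_right \<omega>)"
      using \<omega> fg[of \<omega>] unfolding eventually_at_right[OF \<omega>(2)] by blast
    then have "g \<omega> \<le> f \<omega>"
      by (rule tendsto_lowerbound[OF lim(1)]) simp
    moreover have "eventually (\<lambda>a. f a \<le> g \<omega>) (at_left \<omega>)"
      using \<omega> gf[of _ \<omega>] unfolding eventually_at_left[OF \<omega>(1)] by blast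
    then have "f \<omega> \<le> g \<omega>"
      by (rule tendsto_upperbound[OF lim(2)]) simp
    ultimately show ?case by simp
  qed
qed

text \<open>A relation and not a map, because isometries act on laws and a law fixes its quantile
  function only almost everywhere. The axioms are symmetric in the two sides, so they pass to the
  converse.\<close>

locale pcost_relation =
  fixes p :: real and R :: "(real \<Rightarrow> real) \<Rightarrow> (real \<Rightarrow> real) \<Rightarrow> bool"
  assumes p: "p \<ge> 1"
    and dom: "R f g \<Longrightarrow> quantile_fun p f"
    and ran: "R f g \<Longrightarrow> quantile_fun p g"
    and left_total: "quantile_fun p f \<Longrightarrow> \<exists>g. R f g"
    and right_total: "quantile_fun p g \<Longrightarrow> \<exists>f. R f g"
    and pcost_eq: "R f g \<Longrightarrow> R f' g' \<Longrightarrow> pcost p f f' = pcost p g g'"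
begin

lemma converse: "pcost_relation p (\<lambda>g f. R f g)"
  by (rule pcost_relation.intro)
    (rule p, erule ran, erule dom, erule right_total, erule left_total, erule (1) pcost_eq[symmetric])

text \<open>\<open>g\<close> is the midpoint of \<open>0\<close> and \<open>2 * g\<close>. Preimages
  of these two points have \<open>0\<close> as a midpoint, so by \<open>zero_not_midpoint\<close>
  their distance to \<open>0\<close>, which is the norm of \<open>g\<close>, vanishes.\<close>

lemma zero_AE_zero:
  assumes g: "R (\<lambda>_. 0) g"
  shows "AE \<omega> in unit_ivl. g \<omega> = 0"
proof -
  have qg: "quantile_fun p g" using ran[OF g] .
  have q2: "quantile_fun p (\<lambda>\<omega>. 2 * g \<omega>)"
    by (rule quantile_fun_dominated[OF qg p])
      (use quantile_funD(3,4)[OF qg] in \<open>auto intro!: mono_onI\<close>)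
  obtain k0 where k0: "R k0 (\<lambda>_. 0)" using right_total[OF quantile_fun_zero] by auto
  obtain k2 where k2: "R k2 (\<lambda>\<omega>. 2 * g \<omega>)" using right_total[OF q2] by auto
  have 1: "pcost p k0 (\<lambda>_. 0) = pcost p g (\<lambda>_. 0)" using pcost_eq[OF k0 g] by (simp add: pcost_commute)
  have 2: "pcost p k2 (\<lambda>_. 0) = pcost p g (\<lambda>_. 0)" using pcost_eq[OF k2 g] by (simp add: pcost_def)
  have 3: "pcost p k0 k2 = 2 powr p * pcost p g (\<lambda>_. 0)"
    using pcost_eq[OF k0 k2] by (simp add: pcost_def abs_mult powr_mult)
  have "pcost p k0 (\<lambda>_. 0) = 0"
    by (rule zero_not_midpoint[OF p dom[OF k0] dom[OF k2]]) (use 1 2 3 in simp_all)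
  then show ?thesis using 1 pcost_eq_0_iff[OF qg quantile_fun_zero p] by simp
qed

lemma pcost_zero_eq:
  assumes "R f g"
  shows "pcost p f (\<lambda>_. 0) = pcost p g (\<lambda>_. 0)"
proof -
  obtain z where z: "R (\<lambda>_. 0) z" using left_total[OF quantile_fun_zero] by auto
  have "pcost p f (\<lambda>_. 0) = pcost p g z" by (rule pcost_eq[OF assms z])
  also have "\<dots> = pcost p g (\<lambda>_. 0)"
    by (rule pcost_cong_AE) (use ran[OF assms] ran[OF z] quantile_fun_zero zero_AE_zero[OF z] in auto)
  finally show ?thesis .
qed

text \<open>The witnesses that reveal \<open>f\<close> as no step are described by distances among
  finitely many functions, so their partners under \<open>R\<close> would be such witnesses against
  \<open>g\<close>.\<close>

lemma ae_step_pullback: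
  assumes fg: "R f g" and g: "ae_step g"
  shows "ae_step f"
proof (rule ccontr)
  assume ns: "\<not> ae_step f"
  show False
  proof (cases "p = 1")
    case True
    obtain k1 k2 where k: "quantile_fun 1 k1" "quantile_fun 1 k2"
      "pcost 1 k1 (\<lambda>_. 0) + pcost 1 k1 f = pcost 1 f (\<lambda>_. 0)"
      "pcost 1 k2 (\<lambda>_. 0) + pcost 1 k2 f = pcost 1 f (\<lambda>_. 0)"
      "pcost 1 k1 f + pcost 1 k2 f = pcost 1 k1 k2"
      "pcost 1 k1 f \<noteq> 0" "pcost 1 k2 f \<noteq> 0"
      using nonstep_lattice[OF _ ns] dom[OF fg] True by metis
    obtain l1 where l1: "R k1 l1" using left_total k(1) True by auto
    obtain l2 where l2: "R k2 l2" using left_total k(2) True by auto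
    have "pcost 1 l1 g = 0 \<or> pcost 1 l2 g = 0"
      by (rule step_join_irreducible[OF _ _ _ g])
        (use k pcost_zero_eq[OF fg] pcost_zero_eq[OF l1] pcost_zero_eq[OF l2] pcost_eq[OF l1 fg]
          pcost_eq[OF l2 fg] pcost_eq[OF l1 l2] ran[OF fg] ran[OF l1] ran[OF l2] True in simp_all)
    then show False using pcost_eq[OF l1 fg] pcost_eq[OF l2 fg] k True by simp
  next
    case False
    then have p1: "p > 1" using p by simp
    obtain k1 k1' k2 k2' where k: "quantile_fun p k1" "quantile_fun p k1'"
      "quantile_fun p k2" "quantile_fun p k2'"
      "2 powr p * pcost p k1 f = pcost p k1 k1'" "2 powr p * pcost p f k1' = pcost p k1 k1'"
      "2 powr p * pcost p k2 f = pcost p k2 k2'" "2 powr p * pcost p f k2' = pcost p k2 k2'"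
      "pcost p k1 (\<lambda>_. 0) = pcost p k2 (\<lambda>_. 0)" "pcost p k1 k2 \<noteq> 0"
      by (rule nonstep_midpoints[OF p1 dom[OF fg] ns])
    obtain l1 where l1: "R k1 l1" using left_total[OF k(1)] by blast
    obtain l1' where l1': "R k1' l1'" using left_total[OF k(2)] by blast
    obtain l2 where l2: "R k2 l2" using left_total[OF k(3)] by blast
    obtain l2' where l2': "R k2' l2'" using left_total[OF k(4)] by blast
    have "pcost p l1 l2 = 0"
      by (rule step_midpoints_unique[OF p1 ran[OF fg] ran[OF l1] ran[OF l1'] ran[OF l2] ran[OF l2'] g])
        (use k pcost_zero_eq[OF l1] pcost_zero_eq[OF l2] pcost_eq[OF l1 fg] pcost_eq[OF fg l1']
          pcost_eq[OF l1 l1'] pcost_eq[OF l2 fg] pcost_eq[OF fg l2'] pcost_eq[OF l2 l2'] in simp_all)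
    then show False using pcost_eq[OF l1 l2] k by simp
  qed
qed

lemma ae_step_iff: "R f g \<Longrightarrow> ae_step f \<longleftrightarrow> ae_step g"
  using ae_step_pullback pcost_relation.ae_step_pullback[OF converse] by blast

text \<open>On the sphere of moment \<open>V\<close> steps correspond to steps, so \<open>R\<close>
  induces a relation \<open>S\<close> between masses in \<open>(0, 1]\<close>. It is total on both
  sides and preserves ratios because distances determine them, so \<open>ratio_preserving_eq\<close>
  applies.\<close>

lemma moment_step_fixed:
  assumes V: "V > 0" and fg: "R f g" and f: "AE \<omega> in unit_ivl. f \<omega> = moment_step p V b \<omega>"
    and b: "0 < b" "b \<le> 1"
  shows "AE \<omega> in unit_ivl. g \<omega> = moment_step p V b \<omega>"
proof -
  define S where "S b b' \<longleftrightarrow> 0 < b \<and> b \<le> 1 \<and> 0 < b' \<and> b' \<le> 1 \<and>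
    (\<exists>f g. R f g \<and> (AE \<omega> in unit_ivl. f \<omega> = moment_step p V b \<omega>) \<and>
       (AE \<omega> in unit_ivl. g \<omega> = moment_step p V b' \<omega>))" for b b'
  have ms: "ae_step (moment_step p V b)" if "0 < b" "b \<le> 1" for b
    unfolding moment_step_def using that by (intro ae_step_step) auto
  have right: "\<exists>d'. 0 < d' \<and> d' \<le> 1 \<and> (AE \<omega> in unit_ivl. g \<omega> = moment_step p V d' \<omega>)"
    if "R f g" "AE \<omega> in unit_ivl. f \<omega> = moment_step p V d \<omega>" "0 < d" "d \<le> 1" for d f g
  proof (rule ae_step_moment_step[OF p ran[OF that(1)] _ _ V])
    have "ae_step f"
      using that(2) that(3,4) unfolding ae_step_def moment_step_def
      by (intro exI[of _ "1 - d"] exI[of _ "(V / d) powr (1 / p)"]) auto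
    then show "ae_step g" using ae_step_iff[OF that(1)] by simp
    have "pcost p f (\<lambda>_. 0) = V"
      using pcost_cong_AE[OF dom[OF that(1)] quantile_fun_moment_step quantile_fun_zero quantile_fun_zero that(2)]
        pcost_moment_step_zero[OF p V that(3,4)] by simp
    then show "pcost p g (\<lambda>_. 0) = V" using pcost_zero_eq[OF that(1)] by simp
  qed
  have left': "\<exists>d'. 0 < d' \<and> d' \<le> 1 \<and> (AE \<omega> in unit_ivl. f \<omega> = moment_step p V d' \<omega>)"
    if "R f (moment_step p V d)" "0 < d" "d \<le> 1" for d f
  proof (rule ae_step_moment_step[OF p dom[OF that(1)] _ _ V])
    show "ae_step f" using ae_step_iff[OF that(1)] ms[OF that(2,3)] by simp
    show "pcost p f (\<lambda>_. 0) = V"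
      using pcost_moment_step_zero[OF p V that(2,3)] pcost_zero_eq[OF that(1)] by simp
  qed
  have S_eq: "b = b'" if "S b b'" for b b'
  proof (rule ratio_preserving_eq[of S, OF _ _ _ _ that])
    show "0 < b \<and> b \<le> 1 \<and> 0 < b' \<and> b' \<le> 1" if "S b b'" for b b' using that by (auto simp: S_def)
    show "\<exists>b'. S b b'" if b: "0 < b" "b \<le> 1" for b
    proof -
      obtain g where g: "R (moment_step p V b) g" using left_total[OF quantile_fun_moment_step] by auto
      obtain b' where b': "0 < b'" "b' \<le> 1" "AE \<omega> in unit_ivl. g \<omega> = moment_step p V b' \<omega>"
        using right[OF g _ b] by blast
      have "S b b'" unfolding S_def
        by (intro conjI b b' exI[of _ "moment_step p V b"] exI[of _ g] g) simp
      then show ?thesis ..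
    qed
    show "\<exists>b. S b b'" if b: "0 < b'" "b' \<le> 1" for b'
    proof -
      obtain f where f: "R f (moment_step p V b')" using right_total[OF quantile_fun_moment_step] by auto
      obtain d where d: "0 < d" "d \<le> 1" "AE \<omega> in unit_ivl. f \<omega> = moment_step p V d \<omega>"
        using left'[OF f b] by blast
      have "S d b'" unfolding S_def
        by (intro conjI b d exI[of _ f] exI[of _ "moment_step p V b'"] f) simp
      then show ?thesis ..
    qed
    fix b b' d d' assume "S b b'" "S d d'"
    then obtain f g h k where *: "R f g" "AE \<omega> in unit_ivl. f \<omega> = moment_step p V b \<omega>"
        "AE \<omega> in unit_ivl. g \<omega> = moment_step p V b' \<omega>"
        "R h k" "AE \<omega> in unit_ivl. h \<omega> = moment_step p V d \<omega>"
        "AE \<omega> in unit_ivl. k \<omega> = moment_step p V d' \<omega>"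
      and bd: "0 < b" "b \<le> 1" "0 < d" "d \<le> 1" "0 < b'" "b' \<le> 1" "0 < d'" "d' \<le> 1"
      unfolding S_def by auto
    note q = quantile_fun_moment_step
    show "min b d / max b d = min b' d' / max b' d'"
      using pcost_cong_AE[OF dom[OF *(1)] q dom[OF *(4)] q *(2,5)]
        pcost_cong_AE[OF ran[OF *(1)] q ran[OF *(4)] q *(3,6)] pcost_eq[OF *(1,4)]
      by (intro pcost_moment_step_inj[OF p V bd]) simp
  qed
  obtain b' where b': "0 < b'" "b' \<le> 1" "AE \<omega> in unit_ivl. g \<omega> = moment_step p V b' \<omega>"
    using right[OF fg f b] by auto
  then have "S b b'" using b fg f by (auto simp: S_def)
  from S_eq[OF this] show ?thesis using b'(3) by simp
qed

lemma step_fixed: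
  assumes c: "0 \<le> c" "c < 1" "0 < s" and g: "R (step c s) g"
  shows "AE \<omega> in unit_ivl. g \<omega> = step c s \<omega>"
proof -
  define V where "V = (1 - c) * s powr p"
  have V: "V > 0" using c by (simp add: V_def)
  have e: "step c s = moment_step p V (1 - c)"
    using c p by (simp add: moment_step_def V_def powr_powr)
  then show ?thesis using moment_step_fixed[OF V g, of "1 - c"] c by simp
qed

lemma related_AE_eq:
  assumes fg: "R f g"
  shows "AE \<omega> in unit_ivl. f \<omega> = g \<omega>"
proof -
  have eq: "pcost p f (step c s) = pcost p g (step c s)" if c: "0 \<le> c" "c < 1" "0 < s" for c s
  proof -
    have qs: "quantile_fun p (step c s)" using c by (intro quantile_fun_step) simp
    obtain h where h: "R (step c s) h" using left_total[OF qs] by auto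
    have "pcost p f (step c s) = pcost p g h" by (rule pcost_eq[OF fg h])
    also have "\<dots> = pcost p g (step c s)"
      by (rule pcost_cong_AE) (use ran[OF fg] ran[OF h] qs step_fixed[OF c h] in auto)
    finally show ?thesis .
  qed
  show ?thesis
  proof (rule quantile_AE_eq_if_interlaced)
    show "mono_on {0<..<1} f" using dom[OF fg] by (simp add: quantile_fun_def)
    show "g a \<le> f b" if "0 < a" "a < b" "b < 1" for a b
      by (rule quantile_le_if_same_step_costs[OF p dom[OF fg] ran[OF fg] eq that])
    show "f a \<le> g b" if "0 < a" "a < b" "b < 1" for a b
      by (rule quantile_le_if_same_step_costs[OF p ran[OF fg] dom[OF fg] eq[symmetric] that])
  qed
qed

end

subsection \<open>Optimality of the monotone coupling\<close>

text \<open>The monotone coupling minimises the probability of every quadrant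
  \<open>{x > u, y \<le> v}\<close>; by layer-cake integration it therefore minimises every convex cost.\<close>

lemma (in prob_space) quadrant_monotone_le:
  assumes X [measurable]: "X \<in> borel_measurable M" and Y [measurable]: "Y \<in> borel_measurable M"
    and f: "mono_on {0<..<1} f" and g: "mono_on {0<..<1} g"
    and Xf: "prob {\<omega>\<in>space M. X \<omega> > u} = measure unit_ivl {\<omega>\<in>space unit_ivl. f \<omega> > u}"
    and Yg: "prob {\<omega>\<in>space M. Y \<omega> > v} = measure unit_ivl {\<omega>\<in>space unit_ivl. g \<omega> > v}"
  shows "emeasure unit_ivl {\<omega>\<in>space unit_ivl. g \<omega> \<le> v \<and> u < f \<omega>} \<le>
    emeasure M {\<omega>\<in>space M. Y \<omega> \<le> (v::real) \<and> (u::real) < X \<omega>}"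
proof -
  note [measurable] = borel_measurable_mono_unit_ivl[OF f] borel_measurable_mono_unit_ivl[OF g]
  let ?A = "{\<omega>\<in>space unit_ivl. f \<omega> > u}" and ?B = "{\<omega>\<in>space unit_ivl. g \<omega> > v}"
  let ?A' = "{\<omega>\<in>space M. X \<omega> > u}" and ?B' = "{\<omega>\<in>space M. Y \<omega> > v}"
  have ST: "{\<omega>\<in>space unit_ivl. g \<omega> \<le> v \<and> u < f \<omega>} = ?A - ?B"
    "{\<omega>\<in>space M. Y \<omega> \<le> v \<and> u < X \<omega>} = ?A' - ?B'" by auto
  have "measure unit_ivl (?A - ?B) \<le> prob (?A' - ?B')"
  \<comment> \<open>If some \<open>z\<close> has \<open>f z > u\<close> and
    \<open>g z \<le> v\<close>, monotonicity nests \<open>?B\<close> in \<open>?A\<close>. The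
    difference then has measure exactly that of \<open>?A\<close> minus that of \<open>?B\<close>,
    which is a lower bound under every coupling.\<close>
  proof (cases "?A - ?B = {}")
    case False
    then obtain z where "z \<in> ?A - ?B" by blast
    then have z: "0 < z" "z < 1" "f z > u" "g z \<le> v" by auto
    have "?B \<subseteq> ?A"
    proof
      fix \<omega> assume "\<omega> \<in> ?B"
      then have \<omega>: "0 < \<omega>" "\<omega> < 1" "g \<omega> > v" by auto
      then have "z \<le> \<omega>" using mono_onD[OF g, of \<omega> z] z by (cases "z \<le> \<omega>") auto
      then show "\<omega> \<in> ?A" using mono_onD[OF f, of z \<omega>] z \<omega> by auto
    qed
    moreover have "?A \<in> sets unit_ivl" "?B \<in> sets unit_ivl" by measurable
    ultimately have "measure unit_ivl (?A - ?B) = measure unit_ivl ?A - measure unit_ivl ?B"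
      by (intro unit_ivl.finite_measure_Diff)
    also have "\<dots> = prob ?A' - prob ?B'" using Xf Yg by simp
    also have "\<dots> \<le> prob (?A' - ?B')"
    proof -
      have "prob ?A' \<le> prob ((?A' - ?B') \<union> ?B')" by (intro finite_measure_mono) auto
      also have "\<dots> \<le> prob (?A' - ?B') + prob ?B'" by (intro measure_Un_le) auto
      finally show ?thesis by simp
    qed
    finally show ?thesis .
  next
    case True
    then show ?thesis by (simp only: measure_empty measure_nonneg)
  qed
  then show ?thesis
    unfolding ST by (simp add: emeasure_eq_measure unit_ivl.emeasure_eq_measure)
qed

text \<open>\<open>ennreal\<close> cuts off negative values, so the integrand is the length of
  \<open>{Y \<omega> + r..<X \<omega>}\<close>. Exchanging the integrals turns it into probabilities
  of quadrants.\<close>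

lemma (in prob_space) nn_integral_diff_minus:
  fixes X Y :: "'a \<Rightarrow> real"
  assumes [measurable]: "X \<in> borel_measurable M" "Y \<in> borel_measurable M"
  shows "(\<integral>\<^sup>+\<omega>. ennreal (X \<omega> - Y \<omega> - r) \<partial>M) =
    (\<integral>\<^sup>+u. emeasure M {\<omega>\<in>space M. Y \<omega> \<le> u - r \<and> u < X \<omega>} \<partial>lborel)"
proof -
  interpret pair_sigma_finite M lborel ..
  have "(\<integral>\<^sup>+\<omega>. ennreal (X \<omega> - Y \<omega> - r) \<partial>M) =
      (\<integral>\<^sup>+\<omega>. (\<integral>\<^sup>+u. (if Y \<omega> \<le> u - r \<and> u < X \<omega> then 1 else 0) \<partial>lborel) \<partial>M)"
  proof (rule nn_integral_cong)
    fix \<omega>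
    have "(\<integral>\<^sup>+u. (if Y \<omega> \<le> u - r \<and> u < X \<omega> then 1 else 0) \<partial>lborel) =
        (\<integral>\<^sup>+u. indicator {Y \<omega> + r..<X \<omega>} u \<partial>lborel)"
      by (intro nn_integral_cong) (auto simp: indicator_def)
    also have "\<dots> = ennreal (X \<omega> - Y \<omega> - r)"
      by (cases "Y \<omega> + r \<le> X \<omega>") (auto simp: ennreal_neg algebra_simps)
    finally show "ennreal (X \<omega> - Y \<omega> - r) =
        (\<integral>\<^sup>+u. (if Y \<omega> \<le> u - r \<and> u < X \<omega> then 1 else 0) \<partial>lborel)" by simp
  qed
  also have "\<dots> = (\<integral>\<^sup>+u. (\<integral>\<^sup>+\<omega>. (if Y \<omega> \<le> u - r \<and> u < X \<omega> then 1 else 0) \<partial>M) \<partial>lborel)"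
    by (rule Fubini'[symmetric]) measurable
  also have "\<dots> = (\<integral>\<^sup>+u. emeasure M {\<omega>\<in>space M. Y \<omega> \<le> u - r \<and> u < X \<omega>} \<partial>lborel)"
  proof (rule nn_integral_cong)
    fix u
    have "(\<integral>\<^sup>+\<omega>. (if Y \<omega> \<le> u - r \<and> u < X \<omega> then 1 else 0) \<partial>M) =
        (\<integral>\<^sup>+\<omega>. indicator {\<omega>\<in>space M. Y \<omega> \<le> u - r \<and> u < X \<omega>} \<omega> \<partial>M)"
      by (intro nn_integral_cong) (auto simp: indicator_def)
    then show "(\<integral>\<^sup>+\<omega>. (if Y \<omega> \<le> u - r \<and> u < X \<omega> then 1 else 0) \<partial>M) =
        emeasure M {\<omega>\<in>space M. Y \<omega> \<le> u - r \<and> u < X \<omega>}" by simp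
  qed
  finally show ?thesis .
qed

lemma powr_layer_cake:
  fixes z p :: real
  assumes p: "p > 1" and z: "0 \<le> z"
  shows "(\<integral>\<^sup>+r. ennreal (p * (p - 1) * r powr (p - 2) * max 0 (z - r) * indicator {0..} r) \<partial>lborel) = ennreal (z powr p)"
proof -
  let ?h = "\<lambda>r. p * (p - 1) * r powr (p - 2) * max 0 (z - r) * indicator {0..} r"
  \<comment> \<open>An antiderivative of the integrand on \<open>[0, z]\<close>, with
    \<open>H 0 = 0\<close> and \<open>H z = z powr p\<close>. The weight
    \<open>p * (p - 1) * r powr (p - 2)\<close> is the second derivative of
    \<open>r powr p\<close>.\<close>
  define H where "H r = p * z * r powr (p - 1) - (p - 1) * r powr p" for r
  have "((\<lambda>r. p * (p - 1) * r powr (p - 2) * (z - r)) has_integral (H z - H 0)) {0..z}"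
  \<comment> \<open>\<open>r powr (p - 2)\<close> is unbounded near \<open>0\<close> for
    \<open>p < 2\<close>, so \<open>H\<close> is differentiated only in the interior.\<close>
  proof (rule fundamental_theorem_of_calculus_interior[OF z])
    show "continuous_on {0..z} H"
      unfolding H_def using p by (intro continuous_intros continuous_on_powr') auto
    fix r assume "r \<in> {0<..<z}"
    then have r: "0 < r" by simp
    have "(H has_real_derivative p * z * ((p - 1) * r powr (p - 2)) - (p - 1) * (p * r powr (p - 1))) (at r)"
      unfolding H_def using r by (auto intro!: derivative_eq_intros simp: diff_diff_eq)
    also have "r powr (p - 1) = r powr (p - 2) * r" using r powr_add[of r "p - 2" 1] by simp
    finally show "(H has_vector_derivative p * (p - 1) * r powr (p - 2) * (z - r)) (at r)"
      by (simp add: has_real_derivative_iff_has_vector_derivative algebra_simps)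
  qed
  then have "(?h has_integral (H z - H 0)) {0..z}"
    by (rule has_integral_eq[rotated]) auto
  then have "(?h has_integral (H z - H 0)) UNIV"
    by (rule has_integral_on_superset) (auto simp: indicator_def max_def)
  then have "integral\<^sup>N lborel ?h = ennreal (H z - H 0)"
    using p by (intro nn_integral_has_integral_lborel) auto
  also have "H z - H 0 = z powr p"
    using p z powr_add[of z "p - 1" 1] by (cases "z = 0") (auto simp: H_def algebra_simps)
  finally show ?thesis .
qed

lemma (in prob_space) monotone_coupling_optimal:
  fixes X Y :: "'a \<Rightarrow> real"
  assumes [measurable]: "X \<in> borel_measurable M" "Y \<in> borel_measurable M"
    and f: "mono_on {0<..<1} f" and g: "mono_on {0<..<1} g"
    and Xf: "\<And>u. prob {\<omega>\<in>space M. X \<omega> > u} = measure unit_ivl {\<omega>\<in>space unit_ivl. f \<omega> > u}"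
    and Yg: "\<And>u. prob {\<omega>\<in>space M. Y \<omega> > u} = measure unit_ivl {\<omega>\<in>space unit_ivl. g \<omega> > u}"
    and p: "p \<ge> 1"
  shows "(\<integral>\<^sup>+\<omega>. ennreal (\<bar>f \<omega> - g \<omega>\<bar> powr p) \<partial>unit_ivl) \<le> (\<integral>\<^sup>+\<omega>. ennreal (\<bar>X \<omega> - Y \<omega>\<bar> powr p) \<partial>M)"
proof -
  note [measurable] = borel_measurable_mono_unit_ivl[OF f] borel_measurable_mono_unit_ivl[OF g]
  \<comment> \<open>Splitting by the sign of \<open>z\<close> reduces the two-sided excess to
    quadrants of \<open>(X, Y)\<close> and of \<open>(Y, X)\<close>.\<close>
  have split: "ennreal (max 0 (\<bar>z\<bar> - r)) = ennreal (z - r) + ennreal (- z - r)" if "0 \<le> r" for z r :: real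
    using that by (cases "z \<ge> 0") (auto simp: max_def ennreal_neg)
  have split': "(\<integral>\<^sup>+\<omega>. ennreal (max 0 (\<bar>h \<omega> - k \<omega>\<bar> - r)) \<partial>N) =
      (\<integral>\<^sup>+\<omega>. ennreal (h \<omega> - k \<omega> - r) \<partial>N) + (\<integral>\<^sup>+\<omega>. ennreal (k \<omega> - h \<omega> - r) \<partial>N)"
    if [measurable]: "h \<in> borel_measurable N" "k \<in> borel_measurable N" and "0 \<le> r"
    for h k :: "'b \<Rightarrow> real" and N r
    unfolding split[OF \<open>0 \<le> r\<close>] minus_diff_eq by (intro nn_integral_add) measurable
  have layer: "(\<integral>\<^sup>+\<omega>. ennreal (max 0 (\<bar>f \<omega> - g \<omega>\<bar> - r)) \<partial>unit_ivl) \<le>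
      (\<integral>\<^sup>+\<omega>. ennreal (max 0 (\<bar>X \<omega> - Y \<omega>\<bar> - r)) \<partial>M)" if "0 \<le> r" for r
  proof -
    have "(\<integral>\<^sup>+\<omega>. ennreal (f \<omega> - g \<omega> - r) \<partial>unit_ivl) \<le> (\<integral>\<^sup>+\<omega>. ennreal (X \<omega> - Y \<omega> - r) \<partial>M)"
      by (subst unit_ivl.nn_integral_diff_minus; (measurable; fail)?)
        (subst nn_integral_diff_minus; (measurable; fail)?; intro nn_integral_mono quadrant_monotone_le f g Xf Yg assms(1,2))
    moreover have "(\<integral>\<^sup>+\<omega>. ennreal (g \<omega> - f \<omega> - r) \<partial>unit_ivl) \<le> (\<integral>\<^sup>+\<omega>. ennreal (Y \<omega> - X \<omega> - r) \<partial>M)"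
      by (subst unit_ivl.nn_integral_diff_minus; (measurable; fail)?)
        (subst nn_integral_diff_minus; (measurable; fail)?; intro nn_integral_mono quadrant_monotone_le f g Xf Yg assms(1,2))
    ultimately show ?thesis
      by (subst (1 2) split'[OF _ _ that]; (measurable; fail)?) (rule add_mono)
  qed
  show ?thesis
  \<comment> \<open>The layer weight vanishes at \<open>p = 1\<close>, where the cost is itself the
    layer \<open>r = 0\<close>.\<close>
  proof (cases "p = 1")
    case True
    then show ?thesis using layer[of 0] by simp
  next
    case False
    then have p1: "p > 1" using p by simp
    let ?w = "\<lambda>r. p * (p - 1) * r powr (p - 2) * indicator {0..} r"
    have eq: "(\<integral>\<^sup>+\<omega>. ennreal (\<bar>h \<omega> - k \<omega>\<bar> powr p) \<partial>N) =
        (\<integral>\<^sup>+r. ennreal (?w r) * (\<integral>\<^sup>+\<omega>. ennreal (max 0 (\<bar>h \<omega> - k \<omega>\<bar> - r)) \<partial>N) \<partial>lborel)"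
      if N: "prob_space N" and [measurable]: "h \<in> borel_measurable N" "k \<in> borel_measurable N"
      for h k :: "'b \<Rightarrow> real" and N
    proof -
      interpret N: prob_space N by fact
      interpret pair_sigma_finite N lborel ..
      have "(\<integral>\<^sup>+\<omega>. ennreal (\<bar>h \<omega> - k \<omega>\<bar> powr p) \<partial>N) =
          (\<integral>\<^sup>+\<omega>. (\<integral>\<^sup>+r. ennreal (?w r) * ennreal (max 0 (\<bar>h \<omega> - k \<omega>\<bar> - r)) \<partial>lborel) \<partial>N)"
      proof (rule nn_integral_cong)
        fix \<omega>
        let ?z = "\<bar>h \<omega> - k \<omega>\<bar>"
        have "ennreal (?z powr p) =
            (\<integral>\<^sup>+r. ennreal (p * (p - 1) * r powr (p - 2) * max 0 (?z - r) * indicator {0..} r) \<partial>lborel)"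
          by (rule powr_layer_cake[OF p1, symmetric]) simp
        also have "\<dots> = (\<integral>\<^sup>+r. ennreal (?w r) * ennreal (max 0 (?z - r)) \<partial>lborel)"
        proof (rule nn_integral_cong)
          fix r
          have "0 \<le> ?w r" using p1 by simp
          then show "ennreal (p * (p - 1) * r powr (p - 2) * max 0 (?z - r) * indicator {0..} r) =
              ennreal (?w r) * ennreal (max 0 (?z - r))"
            by (subst ennreal_mult'[symmetric]) (simp_all only: mult_ac)
        qed
        finally show "ennreal (?z powr p) = (\<integral>\<^sup>+r. ennreal (?w r) * ennreal (max 0 (?z - r)) \<partial>lborel)" .
      qed
      also have "\<dots> = (\<integral>\<^sup>+r. (\<integral>\<^sup>+\<omega>. ennreal (?w r) * ennreal (max 0 (\<bar>h \<omega> - k \<omega>\<bar> - r)) \<partial>N) \<partial>lborel)"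
        by (rule Fubini'[symmetric]) measurable
      also have "\<dots> = (\<integral>\<^sup>+r. ennreal (?w r) * (\<integral>\<^sup>+\<omega>. ennreal (max 0 (\<bar>h \<omega> - k \<omega>\<bar> - r)) \<partial>N) \<partial>lborel)"
        by (simp add: nn_integral_cmult)
      finally show ?thesis .
    qed
    have "(\<integral>\<^sup>+r. ennreal (?w r) * (\<integral>\<^sup>+\<omega>. ennreal (max 0 (\<bar>f \<omega> - g \<omega>\<bar> - r)) \<partial>unit_ivl) \<partial>lborel) \<le>
        (\<integral>\<^sup>+r. ennreal (?w r) * (\<integral>\<^sup>+\<omega>. ennreal (max 0 (\<bar>X \<omega> - Y \<omega>\<bar> - r)) \<partial>M) \<partial>lborel)"
    proof (rule nn_integral_mono)
      fix r
      show "ennreal (?w r) * (\<integral>\<^sup>+\<omega>. ennreal (max 0 (\<bar>f \<omega> - g \<omega>\<bar> - r)) \<partial>unit_ivl) \<le>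
          ennreal (?w r) * (\<integral>\<^sup>+\<omega>. ennreal (max 0 (\<bar>X \<omega> - Y \<omega>\<bar> - r)) \<partial>M)"
        using layer[of r] by (cases "0 \<le> r") (auto intro: mult_left_mono)
    qed
    then show ?thesis
      by (subst (1 2) eq) (auto simp: unit_ivl.prob_space_axioms prob_space_axioms)
  qed
qed

subsection \<open>Measures on the ray and their quantile functions\<close>

lemma ray_mtopology: "Metric_space.mtopology {0::real..} (\<lambda>x y. \<bar>x - y\<bar>) = top_of_set {0..}"
proof -
  interpret Submetric "UNIV :: real set" dist "{0::real..}"
    by (simp add: Met_TC.Metric_space_axioms Submetric.intro Submetric_axioms.intro)
  have "(\<lambda>x y :: real. \<bar>x - y\<bar>) = dist" by (simp add: dist_real_def fun_eq_iff)
  then show ?thesis using mtopology_submetric by simp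
qed

lemma space_borel_of: "space (borel_of T) = topspace T"
  by (simp add: borel_of_def space_measure_of_conv)

lemma sets_borel_of_top_of_set:
  fixes S :: "'a::topological_space set"
  assumes "S \<in> sets borel"
  shows "sets (borel_of (top_of_set S)) = sets (restrict_space borel S)"
proof -
  have "{U. openin (top_of_set S) U} = (\<inter>) S ` {U. open U}"
    by (auto simp: openin_open)
  then have "sets (borel_of (top_of_set S)) = sigma_sets S ((\<inter>) S ` {U. open U})"
    unfolding borel_of_def by (simp add: sets_measure_of_conv) blast
  also have "\<dots> = (\<inter>) S ` sigma_sets UNIV {U. open U}"
    using assms by (intro sigma_sets_Int[symmetric]) (simp_all add: borel_def)
  also have "\<dots> = sets (restrict_space borel S)"
    by (simp add: sets_restrict_space borel_def)
  finally show ?thesis .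
qed

abbreviation ray_borel :: "real measure" where
  "ray_borel \<equiv> borel_of (top_of_set {0..})"

abbreviation quadrant_borel :: "(real \<times> real) measure" where
  "quadrant_borel \<equiv> borel_of (top_of_set ({0..} \<times> {0..}))"

lemma sets_ray_borel: "sets ray_borel = sets (restrict_space borel {0..})"
  by (rule sets_borel_of_top_of_set) simp

lemma sets_quadrant_borel: "sets quadrant_borel = sets (restrict_space borel ({0..} \<times> {0..}))"
  by (intro sets_borel_of_top_of_set borel_closed closed_Times) auto

definition law :: "(real \<Rightarrow> real) \<Rightarrow> real measure" where
  "law f = distr unit_ivl ray_borel f"

lemma measurable_into_ray: "f \<in> measurable M ray_borel \<longleftrightarrow> f \<in> borel_measurable M \<and> f \<in> space M \<rightarrow> {0..}"
proof -
  have "measurable M ray_borel = measurable M (restrict_space borel {0..})"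
    by (intro measurable_cong_sets sets_ray_borel refl)
  then show ?thesis by (simp add: measurable_restrict_space2_iff)
qed

lemma measurable_into_quadrant:
  "f \<in> measurable M quadrant_borel \<longleftrightarrow> f \<in> borel_measurable M \<and> f \<in> space M \<rightarrow> {0..} \<times> {0..}"
proof -
  have "measurable M quadrant_borel = measurable M (restrict_space borel ({0..} \<times> {0..}))"
    by (intro measurable_cong_sets sets_quadrant_borel refl)
  then show ?thesis by (simp add: measurable_restrict_space2_iff)
qed

lemma quantile_fun_measurable_ray: "quantile_fun p f \<Longrightarrow> f \<in> measurable unit_ivl ray_borel"
  using quantile_funD(1,3) by (auto simp: measurable_into_ray)

lemma borel_measurable_ray: "f \<in> borel_measurable borel \<Longrightarrow> f \<in> borel_measurable ray_borel"
  using measurable_cong_sets[OF sets_ray_borel refl] measurable_restrict_space1 by blast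

lemma borel_measurable_quadrant: "f \<in> borel_measurable borel \<Longrightarrow> f \<in> borel_measurable quadrant_borel"
  using measurable_cong_sets[OF sets_quadrant_borel refl] measurable_restrict_space1 by blast

section \<open>Measures of finite moment as laws of quantile functions\<close>

lemma law_in_wasserstein_space:
  assumes f: "quantile_fun p f"
  shows "law f \<in> wasserstein_space p {0..} (\<lambda>x y. \<bar>x - y\<bar>)"
proof -
  note m = quantile_fun_measurable_ray[OF f]
  have "integrable (law f) (\<lambda>x. \<bar>x - 0\<bar> powr p)"
    unfolding law_def
  proof (subst integrable_distr_eq[OF m])
    show "(\<lambda>x. \<bar>x - 0\<bar> powr p) \<in> borel_measurable ray_borel" by (intro borel_measurable_ray) measurable
    have "integrable unit_ivl (\<lambda>\<omega>. \<bar>f \<omega> - 0\<bar> powr p) = integrable unit_ivl (\<lambda>\<omega>. f \<omega> powr p)"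
      using quantile_funD(3)[OF f] by (intro Bochner_Integration.integrable_cong) auto
    then show "integrable unit_ivl (\<lambda>\<omega>. \<bar>f \<omega> - 0\<bar> powr p)" using quantile_funD(2)[OF f] by simp
  qed
  then show ?thesis
    using unit_ivl.prob_space_distr[OF m]
    unfolding wasserstein_space_def prob_measures_def ray_mtopology
    by (auto simp: law_def intro!: bexI[of _ 0])
qed

lemma law_cong_AE:
  assumes "quantile_fun p f" "quantile_fun p g" "AE \<omega> in unit_ivl. f \<omega> = g \<omega>"
  shows "law f = law g"
  unfolding law_def using assms by (intro distr_cong_AE quantile_fun_measurable_ray) auto

text \<open>The quantile function is the pseudoinverse \<open>N.I\<close> of the distribution
  function. It is built for the copy \<open>N\<close> of \<open>\<mu>\<close> on
  \<open>borel\<close>, because \<open>cdf_distribution\<close> concerns measures on the whole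
  line.\<close>

lemma wasserstein_space_law:
  assumes \<mu>: "\<mu> \<in> wasserstein_space p {0..} (\<lambda>x y. \<bar>x - y\<bar>)" and p: "p \<ge> 1"
  shows "\<exists>f. quantile_fun p f \<and> law f = \<mu>"
proof -
  obtain x0 where sets_\<mu>: "sets \<mu> = sets ray_borel" and "prob_space \<mu>" and x0: "0 \<le> x0"
    and int: "integrable \<mu> (\<lambda>x. \<bar>x - x0\<bar> powr p)"
    using \<mu> unfolding wasserstein_space_def prob_measures_def ray_mtopology by auto
  interpret \<mu>: prob_space \<mu> by fact
  have space_\<mu>: "space \<mu> = {0..}" using sets_eq_imp_space_eq[OF sets_\<mu>] by (simp add: space_borel_of)
  have id: "(\<lambda>x. x) \<in> borel_measurable \<mu>"
    using borel_measurable_ray[of "\<lambda>x. x"] measurable_cong_sets[OF sets_\<mu> refl] by auto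
  define N where "N = distr \<mu> borel (\<lambda>x. x)"
  interpret N: prob_space N unfolding N_def by (rule \<mu>.prob_space_distr[OF id])
  interpret N: cdf_distribution N
    by unfold_locales (simp_all add: N_def)
  have U: "restrict_space lborel {0<..<1} = unit_ivl" by (simp add: unit_ivl_def)
  have distr_I: "distr unit_ivl borel N.I = N" using N.distr_I_eq_M by (simp add: U)
  have I_nonneg: "0 \<le> N.I \<omega>" if "\<omega> \<in> {0<..<1}" for \<omega>
  proof (rule ccontr)
    assume "\<not> 0 \<le> N.I \<omega>"
    then have neg: "N.I \<omega> < 0" by simp
    \<comment> \<open>A negative value of \<open>N.I\<close> would be a point where the distribution
      function is positive, but \<open>\<mu>\<close> has no mass to the left of
      \<open>0\<close>.\<close>
    have "\<omega> \<le> cdf N (N.I \<omega>)"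
      by (rule N.pseudoinverse[THEN iffD2]) (use that in auto)
    also have "cdf N (N.I \<omega>) = measure \<mu> ((\<lambda>x. x) -` {..N.I \<omega>} \<inter> space \<mu>)"
      unfolding cdf_def N_def by (rule measure_distr[OF id]) simp
    also have "(\<lambda>x. x) -` {..N.I \<omega>} \<inter> space \<mu> = {}"
      using neg unfolding space_\<mu> by auto
    finally show False using that by simp
  qed
  have meas_I: "N.I \<in> borel_measurable unit_ivl" by (rule borel_measurable_mono_unit_ivl[OF N.mono_I])
  have mI: "N.I \<in> measurable unit_ivl ray_borel"
    using I_nonneg meas_I by (auto simp: measurable_into_ray)
  have law: "law N.I = \<mu>"
  proof (rule measure_eqI)
    show "sets (law N.I) = sets \<mu>" by (simp add: law_def sets_\<mu>)
    fix A assume A: "A \<in> sets (law N.I)"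
    then have A': "A \<in> sets borel" "A \<subseteq> {0..}"
      by (auto simp: law_def sets_ray_borel sets_restrict_space_iff)
    have "emeasure (law N.I) A = emeasure (distr unit_ivl borel N.I) A"
      using A A' mI meas_I by (simp add: law_def emeasure_distr)
    also have "\<dots> = emeasure N A" by (simp only: distr_I)
    also have "\<dots> = emeasure \<mu> A"
      unfolding N_def using A' id by (simp add: emeasure_distr space_\<mu> Int_absorb2)
    finally show "emeasure (law N.I) A = emeasure \<mu> A" .
  qed
  have "integrable (law N.I) (\<lambda>x. \<bar>x - x0\<bar> powr p)" using int by (simp add: law)
  then have intI: "integrable unit_ivl (\<lambda>\<omega>. \<bar>N.I \<omega> - x0\<bar> powr p)"
    unfolding law_def by (subst (asm) integrable_distr_eq[OF mI]) (intro borel_measurable_ray, measurable)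
  have "integrable unit_ivl (\<lambda>\<omega>. N.I \<omega> powr p)"
  proof (rule Bochner_Integration.integrable_bound)
    show "integrable unit_ivl (\<lambda>\<omega>. 2 powr p * (\<bar>N.I \<omega> - x0\<bar> powr p + x0 powr p))" using intI by simp
    show "(\<lambda>\<omega>. N.I \<omega> powr p) \<in> borel_measurable unit_ivl" using meas_I by measurable
    \<comment> \<open>The moment is given about some \<open>x0\<close>; convexity moves it to
      \<open>0\<close>.\<close>
    have "N.I \<omega> powr p \<le> 2 powr p * (\<bar>N.I \<omega> - x0\<bar> powr p + x0 powr p)" if "\<omega> \<in> {0<..<1}" for \<omega>
      using abs_add_powr_le[OF p, of "N.I \<omega> - x0" x0] I_nonneg[OF that] x0
        powr_ge_zero[of "N.I \<omega>" p] by (simp del: powr_ge_zero)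
    then show "AE \<omega> in unit_ivl. norm (N.I \<omega> powr p) \<le> norm (2 powr p * (\<bar>N.I \<omega> - x0\<bar> powr p + x0 powr p))"
      by (intro AE_I2) simp
  qed
  then have "quantile_fun p N.I" using N.mono_I I_nonneg by (simp add: quantile_fun_def)
  with law show ?thesis by blast
qed

lemma wasserstein_dist_law:
  assumes f: "quantile_fun p f" and g: "quantile_fun p g" and p: "p \<ge> 1"
  shows "wasserstein_dist p {0..} (\<lambda>x y. \<bar>x - y\<bar>) (law f) (law g) = pcost p f g powr (1 / p)"
proof -
  let ?C = "couplings {0..} (\<lambda>x y. \<bar>x - y\<bar>) (law f) (law g)"
  let ?c = "\<lambda>\<pi>. (\<integral>(x, y). \<bar>x - y\<bar> powr p \<partial>\<pi>)"
  have C: "?C = {\<pi>. sets \<pi> = sets quadrant_borel \<and> prob_space \<pi> \<and>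
      distr \<pi> ray_borel fst = law f \<and> distr \<pi> ray_borel snd = law g}"
    unfolding couplings_def prob_measures_def ray_mtopology by auto
  note mf = quantile_fun_measurable_ray[OF f] and mg = quantile_fun_measurable_ray[OF g]
  have cost_meas: "(\<lambda>(x, y). \<bar>x - y\<bar> powr p) \<in> borel_measurable quadrant_borel"
    by (intro borel_measurable_quadrant) (simp add: borel_prod[symmetric])
  have fst_meas: "fst \<in> measurable quadrant_borel ray_borel" and snd_meas: "snd \<in> measurable quadrant_borel ray_borel"
    by (auto simp: measurable_into_ray space_borel_of intro!: borel_measurable_quadrant borel_measurable_continuous_onI continuous_intros)
  \<comment> \<open>The monotone coupling: both coordinates are driven by the same uniform
    variable.\<close>
  define \<pi>0 where "\<pi>0 = distr unit_ivl quadrant_borel (\<lambda>\<omega>. (f \<omega>, g \<omega>))"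
  have mfg: "(\<lambda>\<omega>. (f \<omega>, g \<omega>)) \<in> measurable unit_ivl quadrant_borel"
    using quantile_funD(1,3)[OF f] quantile_funD(1,3)[OF g] by (auto simp: measurable_into_quadrant)
  have "\<pi>0 \<in> ?C"
    unfolding C \<pi>0_def
    using unit_ivl.prob_space_distr[OF mfg] fst_meas snd_meas mfg by (simp add: distr_distr comp_def law_def)
  have c0: "?c \<pi>0 = pcost p f g"
    unfolding \<pi>0_def pcost_def using mfg cost_meas by (subst integral_distr) simp_all
  have lower: "pcost p f g \<le> ?c \<pi>" if "\<pi> \<in> ?C" for \<pi>
  proof -
    have sets_\<pi>: "sets \<pi> = sets quadrant_borel" and "prob_space \<pi>"
      and d: "distr \<pi> ray_borel fst = law f" "distr \<pi> ray_borel snd = law g"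
      using that unfolding C by auto
    interpret \<pi>: prob_space \<pi> by fact
    have m\<pi>: "measurable \<pi> = measurable quadrant_borel" by (intro ext measurable_cong_sets sets_\<pi> refl)
    have space_\<pi>: "space \<pi> = {0..} \<times> {0..}" using sets_eq_imp_space_eq[OF sets_\<pi>] by (simp add: space_borel_of)
    have [measurable]: "fst \<in> borel_measurable \<pi>" "snd \<in> borel_measurable \<pi>"
      using fst_meas snd_meas by (auto simp: m\<pi> measurable_into_ray)
    have marg: "measure \<pi> {\<omega>\<in>space \<pi>. h \<omega> > u} = measure unit_ivl {\<omega>\<in>space unit_ivl. k \<omega> > u}"
      if "distr \<pi> ray_borel h = law k" "h \<in> measurable quadrant_borel ray_borel" "quantile_fun p k" for h k u
    proof -
      let ?A = "{x\<in>space ray_borel. x > u}"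
      have A: "?A \<in> sets ray_borel"
        by (simp add: sets_ray_borel space_borel_of sets_restrict_space_iff) (auto simp: Collect_conj_eq)
      have "measure (distr \<pi> ray_borel h) ?A = measure (distr unit_ivl ray_borel k) ?A"
        using that(1) by (simp add: law_def)
      moreover have "h -` ?A \<inter> space \<pi> = {\<omega>\<in>space \<pi>. h \<omega> > u}"
        using measurable_space[OF that(2)] sets_eq_imp_space_eq[OF sets_\<pi>] by auto
      moreover have "k -` ?A \<inter> space unit_ivl = {\<omega>\<in>space unit_ivl. k \<omega> > u}"
        using measurable_space[OF quantile_fun_measurable_ray[OF that(3)]] by auto
      ultimately show ?thesis
        using that(2) quantile_fun_measurable_ray[OF that(3)] A by (simp add: measure_distr m\<pi>)
    qed
    have le: "(\<integral>\<^sup>+\<omega>. ennreal (\<bar>f \<omega> - g \<omega>\<bar> powr p) \<partial>unit_ivl) \<le> (\<integral>\<^sup>+z. ennreal (\<bar>fst z - snd z\<bar> powr p) \<partial>\<pi>)"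
      using f g p marg[OF d(1) fst_meas f] marg[OF d(2) snd_meas g]
      by (intro \<pi>.monotone_coupling_optimal) (auto simp: quantile_fun_def)
    have mom: "integrable \<pi> (\<lambda>z. h z powr p)"
      if "distr \<pi> ray_borel h = law k" "h \<in> measurable quadrant_borel ray_borel" "quantile_fun p k" for h k
    proof -
      have b: "(\<lambda>x. x powr p) \<in> borel_measurable ray_borel" by (intro borel_measurable_ray) measurable
      have "integrable (distr \<pi> ray_borel h) (\<lambda>x. x powr p)"
        unfolding that(1) law_def
        using quantile_funD(2)[OF that(3)] by (subst integrable_distr_eq[OF quantile_fun_measurable_ray[OF that(3)] b])
      then show ?thesis using that(2) by (subst (asm) integrable_distr_eq[OF _ b]) (simp_all add: m\<pi>)
    qed
    \<comment> \<open>A non-integrable cost would have Bochner integral \<open>0\<close> and break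
      the lower bound. As both coordinates are nonnegative, the sum of their \<open>p\<close>-th
      powers dominates.\<close>
    have int: "integrable \<pi> (\<lambda>z. \<bar>fst z - snd z\<bar> powr p)"
    proof (rule Bochner_Integration.integrable_bound)
      show "integrable \<pi> (\<lambda>z. fst z powr p + snd z powr p)"
        using mom[OF d(1) fst_meas f] mom[OF d(2) snd_meas g] by simp
      have "\<bar>x - y\<bar> powr p \<le> x powr p + y powr p" if "0 \<le> x" "0 \<le> y" for x y :: real
      proof -
        have "\<bar>x - y\<bar> powr p \<le> max x y powr p" using that p by (intro powr_mono2) auto
        then show ?thesis by (auto simp: max_def add_increasing add_increasing2 split: if_splits)
      qed
      then show "AE z in \<pi>. norm (\<bar>fst z - snd z\<bar> powr p) \<le> norm (fst z powr p + snd z powr p)"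
        by (intro AE_I2) (auto simp: space_\<pi>)
    qed measurable
    have "ennreal (pcost p f g) \<le> ennreal (\<integral>z. \<bar>fst z - snd z\<bar> powr p \<partial>\<pi>)"
      using le unfolding pcost_def
      by (subst (asm) (1 2) nn_integral_eq_integral) (use int integrable_pcost[OF f g p] in auto)
    then show ?thesis by (simp add: case_prod_unfold ennreal_le_iff)
  qed
  show ?thesis
    unfolding wasserstein_dist_def
  proof (rule cInf_eq_minimum)
    show "pcost p f g powr (1 / p) \<in> (\<lambda>\<pi>. ?c \<pi> powr (1 / p)) ` ?C"
      using \<open>\<pi>0 \<in> ?C\<close> c0 by (intro image_eqI[of _ _ \<pi>0]) simp_all
    fix x assume "x \<in> (\<lambda>\<pi>. ?c \<pi> powr (1 / p)) ` ?C"
    then show "pcost p f g powr (1 / p) \<le> x"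
      using lower p by (auto intro!: powr_mono2 pcost_nonneg)
  qed
qed

theorem theorem3:
  fixes p :: real
  assumes "p \<ge> 1"
  shows "isometrically_rigid p {0::real..} (\<lambda>x y. \<bar>x - y\<bar>)"
  unfolding isometrically_rigid_def
proof (intro allI impI exI conjI ballI)
  let ?X = "wasserstein_space p {0::real..} (\<lambda>x y. \<bar>x - y\<bar>)"
  let ?W = "wasserstein_dist p {0::real..} (\<lambda>x y. \<bar>x - y\<bar>)"
  fix \<Phi> assume iso: "self_isometry ?X ?W \<Phi>"
  \<comment> \<open>The ray has no isometry except the identity, so this is the only possible
    witness.\<close>
  show "self_isometry {0::real..} (\<lambda>x y. \<bar>x - y\<bar>) (\<lambda>x. x)" by (simp add: self_isometry_def)
  have onto: "\<Phi> ` ?X = ?X" and dist: "\<And>\<mu> \<nu>. \<mu> \<in> ?X \<Longrightarrow> \<nu> \<in> ?X \<Longrightarrow> ?W (\<Phi> \<mu>) (\<Phi> \<nu>) = ?W \<mu> \<nu>"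
    using iso by (auto simp: self_isometry_def)
  define R where "R f g \<longleftrightarrow> quantile_fun p f \<and> quantile_fun p g \<and> \<Phi> (law f) = law g" for f g
  have "pcost_relation p R"
  proof
    show "p \<ge> 1" by fact
    show "quantile_fun p f" "quantile_fun p g" if "R f g" for f g using that by (auto simp: R_def)
    show "\<exists>g. R f g" if f: "quantile_fun p f" for f
    proof -
      have "\<Phi> (law f) \<in> ?X" using onto law_in_wasserstein_space[OF f] by blast
      from wasserstein_space_law[OF this assms] show ?thesis using f by (auto simp: R_def)
    qed
    show "\<exists>f. R f g" if g: "quantile_fun p g" for g
    proof -
      have "law g \<in> \<Phi> ` ?X" using onto law_in_wasserstein_space[OF g] by simp
      then obtain \<mu> where \<mu>: "\<mu> \<in> ?X" "\<Phi> \<mu> = law g" by auto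
      from wasserstein_space_law[OF \<mu>(1) assms] show ?thesis using g \<mu> by (auto simp: R_def)
    qed
    show "pcost p f f' = pcost p g g'" if "R f g" "R f' g'" for f g f' g'
    proof -
      have "?W (law g) (law g') = ?W (law f) (law f')"
        using that dist[OF law_in_wasserstein_space law_in_wasserstein_space, of f f'] by (auto simp: R_def)
      then have "pcost p g g' powr (1 / p) = pcost p f f' powr (1 / p)"
        using that assms by (simp add: R_def wasserstein_dist_law)
      then have "(pcost p g g' powr (1 / p)) powr p = (pcost p f f' powr (1 / p)) powr p" by simp
      then show ?thesis using assms pcost_nonneg by (simp add: powr_powr)
    qed
  qed
  then interpret pcost_relation p R .
  fix \<mu> assume \<mu>: "\<mu> \<in> ?X"
  then obtain f where f: "quantile_fun p f" "law f = \<mu>" using wasserstein_space_law[OF _ assms] by blast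
  obtain g where g: "R f g" using left_total[OF f(1)] by auto
  have "law f = law g" using g by (intro law_cong_AE[OF _ _ related_AE_eq[OF g]]) (auto simp: R_def)
  then have "\<Phi> \<mu> = \<mu>" using f g by (simp add: R_def)
  also have "\<mu> = distr \<mu> (metric_borel {0..} (\<lambda>x y. \<bar>x - y\<bar>)) (\<lambda>x. x)"
    using \<mu> by (subst distr_id2) (auto simp: wasserstein_space_def prob_measures_def)
  finally show "\<Phi> \<mu> = distr \<mu> (metric_borel {0..} (\<lambda>x y. \<bar>x - y\<bar>)) (\<lambda>x. x)" .
qed

end
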